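(* If $M$ is a nonempty simple orientable matroid, the numerator of its reduced magnitude (that is, the polynomial $P_M$ when $\operatorname{Mag}(M;q)=P_M(q)/Q_M(q)$ is written in lowest terms) has no real root. Moreover, $q=-1$ is a pole of $\operatorname{Mag}(M;q)$.
   Context: All matroids are finite; nonempty means that the ground set is nonempty. A matroid is orientable if it is the underlying matroid of some oriented matroid. For a matroid $M$ on $E$ with rank function $r_M$ and $r(M)=r_M(E)$, $\chi_M(x)=\sum_{S\subseteq E}(-1)^{|S|}x^{r(M)-r_M(S)}$. For $w\in\mathbb Z_{\ge0}^E$ put $|w|=\sum_ew_e$, $\operatorname{wt}_M(w)=\max_B\sum_{e\in B}w_e$ over bases $B$ of $M$; the maximizing bases are the bases of the initial matroid $M_w$ on $E$. The motivic zeta function is $Z_M(x,T)=\sum_{w\in\mathbb Z_{\ge0}^E}\chi_{M_w}(x)x^{-r(M)-\operatorname{wt}_M(w)}T^{|w|}$, and the magnitude is $\operatorname{Mag}(M;q)=Z_M(-1,q)\in\mathbb Z[[q]]$, which for loopless $M$ is a rational function that can be written in lowest terms as $P_M/Q_M$ with $P_M,Q_M\in\mathbb Z[q]$, $Q_M(0)=1$. *)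

theory Defs
  imports "HOL-Complex_Analysis.Complex_Analysis" "HOL-Computational_Algebra.Computational_Algebra"
begin

section \<open>Matroids\<close>

record 'a matroid =
  ground :: "'a set"
  bases :: "'a set set"

definition is_matroid :: "'a matroid \<Rightarrow> bool" where
  "is_matroid M \<longleftrightarrow>
     finite (ground M) \<and> bases M \<noteq> {} \<and> (\<forall>B\<in>bases M. B \<subseteq> ground M) \<and>
     (\<forall>A\<in>bases M. \<forall>B\<in>bases M. \<forall>a\<in>A - B. \<exists>b\<in>B - A. insert b (A - {a}) \<in> bases M)"

definition indep :: "'a matroid \<Rightarrow> 'a set \<Rightarrow> bool" where
  "indep M I \<longleftrightarrow> (\<exists>B\<in>bases M. I \<subseteq> B)"

definition circuit :: "'a matroid \<Rightarrow> 'a set \<Rightarrow> bool" where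
  "circuit M C \<longleftrightarrow> C \<subseteq> ground M \<and> \<not> indep M C \<and> (\<forall>D. D \<subset> C \<longrightarrow> indep M D)"

definition rk :: "'a matroid \<Rightarrow> 'a set \<Rightarrow> nat" where
  "rk M S = Max (card ` {I. I \<subseteq> S \<and> indep M I})"

text \<open>A loop is a circuit of size 1, and two distinct elements are parallel if they form a
  circuit of size 2.\<close>

definition simple_matroid :: "'a matroid \<Rightarrow> bool" where
  "simple_matroid M \<longleftrightarrow> (\<forall>e. \<not> circuit M {e}) \<and> (\<forall>e f. e \<noteq> f \<longrightarrow> \<not> circuit M {e, f})"

section \<open>Oriented matroids\<close>

text \<open>A signed set is the pair of its positive and its negative part; oriented matroids are
  given by their signed circuits.\<close>

definition supp :: "'a set \<times> 'a set \<Rightarrow> 'a set" where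
  "supp X = fst X \<union> snd X"

definition oriented_matroid :: "'a set \<Rightarrow> ('a set \<times> 'a set) set \<Rightarrow> bool" where
  "oriented_matroid E \<C> \<longleftrightarrow>
     finite E \<and>
     (\<forall>X\<in>\<C>. supp X \<subseteq> E \<and> fst X \<inter> snd X = {}) \<and>
     ({}, {}) \<notin> \<C> \<and>
     (\<forall>X\<in>\<C>. prod.swap X \<in> \<C>) \<and>
     (\<forall>X\<in>\<C>. \<forall>Y\<in>\<C>. supp X \<subseteq> supp Y \<longrightarrow> X = Y \<or> X = prod.swap Y) \<and>
     (\<forall>X\<in>\<C>. \<forall>Y\<in>\<C>. \<forall>e. X \<noteq> prod.swap Y \<and> e \<in> fst X \<inter> snd Y \<longrightarrow>
        (\<exists>Z\<in>\<C>. fst Z \<subseteq> (fst X \<union> fst Y) - {e} \<and> snd Z \<subseteq> (snd X \<union> snd Y) - {e}))"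

definition orientable :: "'a matroid \<Rightarrow> bool" where
  "orientable M \<longleftrightarrow>
     (\<exists>\<C>. oriented_matroid (ground M) \<C> \<and> {C. circuit M C} = supp ` \<C>)"

section \<open>Magnitude\<close>

definition char_poly :: "'a matroid \<Rightarrow> int poly" where
  "char_poly M =
     (\<Sum>S\<in>Pow (ground M). monom ((-1) ^ card S) (rk M (ground M) - rk M S))"

definition wt :: "'a matroid \<Rightarrow> ('a \<Rightarrow> nat) \<Rightarrow> nat" where
  "wt M w = Max ((\<lambda>B. sum w B) ` bases M)"

definition initial_matroid :: "'a matroid \<Rightarrow> ('a \<Rightarrow> nat) \<Rightarrow> 'a matroid" where
  "initial_matroid M w = \<lparr>ground = ground M, bases = {B \<in> bases M. sum w B = wt M w}\<rparr>"

definition weights :: "'a matroid \<Rightarrow> nat \<Rightarrow> ('a \<Rightarrow> nat) set" where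
  "weights M n = {w \<in> ground M \<rightarrow>\<^sub>E UNIV. sum w (ground M) = n}"

text \<open>The variable \<open>x\<close> is a nonzero element of an arbitrary field; the coefficients are
  Laurent polynomials in \<open>x\<close>.\<close>

definition motivic_zeta :: "'a matroid \<Rightarrow> 'b::field \<Rightarrow> 'b fps" where
  "motivic_zeta M x =
     Abs_fps (\<lambda>n. \<Sum>w\<in>weights M n.
        poly (map_poly of_int (char_poly (initial_matroid M w))) x *
        x powi (- int (rk M (ground M)) - int (wt M w)))"

definition magnitude :: "'a matroid \<Rightarrow> rat fps" where
  "magnitude M = motivic_zeta M (-1)"

definition lowest_terms :: "rat fps \<Rightarrow> int poly \<Rightarrow> int poly \<Rightarrow> bool" where
  "lowest_terms F P Q \<longleftrightarrow>
     coprime P Q \<and> coeff Q 0 = 1 \<and>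
     F * fps_of_poly (map_poly of_int Q) = fps_of_poly (map_poly of_int P)"

section \<open>Well-definedness\<close>

lemma finite_weights:
  assumes "is_matroid M"
  shows "finite (weights M n)"
proof -
  have fin: "finite (ground M)" using assms by (simp add: is_matroid_def)
  have "w e \<le> n" if "w \<in> weights M n" "e \<in> ground M" for w e
    using that fin member_le_sum[of e "ground M" w] by (auto simp: weights_def)
  then have "weights M n \<subseteq> ground M \<rightarrow>\<^sub>E {..n}"
    by (auto simp: weights_def PiE_iff extensional_def)
  then show ?thesis
    using finite_PiE[OF fin, of "\<lambda>_. {..n}"] finite_subset by blast
qed

lemma magnitude_in_Ints: "fps_nth (magnitude M) n \<in> \<int>"
proof -
  have "poly (map_poly of_int p) (-1 :: rat) = of_int (poly p (-1))" for p :: "int poly"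
    by (induction p) (auto simp: map_poly_pCons)
  moreover have "(-1 :: rat) powi k \<in> \<int>" for k :: int
    by (cases "even k") auto
  ultimately show ?thesis
    by (auto simp: magnitude_def motivic_zeta_def intro!: Ints_sum Ints_mult)
qed

text \<open>A fraction in lowest terms is determined by the series, because the condition
  \<open>coeff Q 0 = 1\<close> fixes the sign.\<close>

lemma lowest_terms_unique:
  assumes "lowest_terms F P Q" "lowest_terms F P' Q'"
  shows "P = P'" "Q = Q'"
proof -
  let ?h = "map_poly of_int :: int poly \<Rightarrow> rat poly"
  have h_mult: "?h (p * q) = ?h p * ?h q" for p q
    by (rule poly_eqI) (simp add: coeff_map_poly coeff_mult)
  have inj: "p = q" if "?h p = ?h q" for p q
    using that by (auto simp: poly_eq_iff coeff_map_poly)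
  define q q' where "q = fps_of_poly (?h Q)" and "q' = fps_of_poly (?h Q')"
  have "fps_of_poly (?h P) = F * q" "fps_of_poly (?h P') = F * q'"
    using assms by (simp_all add: lowest_terms_def q_def q'_def)
  then have "fps_of_poly (?h P) * q' = fps_of_poly (?h P') * q"
    by (simp add: mult_ac)
  then have "fps_of_poly (?h P * ?h Q') = fps_of_poly (?h P' * ?h Q)"
    by (simp add: q_def q'_def fps_of_poly_mult)
  then have "?h P * ?h Q' = ?h P' * ?h Q"
    by (simp only: fps_of_poly_eq_iff)
  then have eq: "P * Q' = P' * Q"
    by (intro inj) (simp add: h_mult)
  have "Q dvd Q'" "Q' dvd Q"
    using assms eq
    by (metis lowest_terms_def coprime_commute coprime_dvd_mult_right_iff dvd_triv_right)+
  then obtain a b where a: "Q' = Q * a" and b: "Q = Q' * b" unfolding dvd_def by blast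
  have "Q \<noteq> 0" using assms by (auto simp: lowest_terms_def)
  moreover have "Q * (a * b) = Q * 1" using a b by (metis mult.assoc mult_1_right)
  ultimately have "a * b = 1" by (metis mult_left_cancel)
  then have "a dvd 1" by (metis dvd_triv_left)
  then obtain c where "a = [:c:]" by (auto simp: is_unit_poly_iff)
  moreover have "coeff (Q * a) 0 = 1" "coeff Q 0 = 1"
    using assms a by (auto simp: lowest_terms_def)
  ultimately have "a = 1" by (simp add: coeff_mult one_pCons)
  then show "Q = Q'" using a by simp
  then show "P = P'" using eq \<open>Q \<noteq> 0\<close> by simp
qed

end

theory Submission
  imports Defs
begin

text \<open>The magnitude is identified with the magnitude of the set of topes under the Hamming metric.
  A weight \<open>w\<close> contributes to a tope \<open>N\<close> of the oriented matroid exactly when \<open>N\<close> is a tope of the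
  initial oriented matroid of \<open>w\<close>; by the Las Vergnas count of topes, summing the resulting series
  \<open>u\<^sub>N = \<Sum>\<^sub>w (-1)\<^bsup>wt w\<^esup> q\<^bsup>|w|\<^esup>\<close> over all topes gives the magnitude. On the other hand \<open>u\<close> is the
  weighting of the matrix \<open>V = (q\<^bsup>d(N, N')\<^esup>)\<close>, that is \<open>V u = 1\<close>: collecting the terms with fixed
  \<open>w + 1\<^sub>D\<close>, where \<open>D\<close> separates the two topes, and varying only the top level of that function, one
  is left with an Euler relation for the faces of a region, which vanishes by deletion.

  The kernel \<open>q\<^bsup>d\<^esup>\<close> is positive semidefinite for \<open>|q| \<le> 1\<close>, being a tensor power of a two by two
  matrix. Hence \<open>Q\<^sup>2 \<le> P Q\<close> there, and \<open>2 Q\<^sup>2 \<le> (1 + q) P Q\<close> because there are two topes at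
  distance one. The antipodal map carries \<open>q\<close> to \<open>1/q\<close> and gives \<open>Q\<^sup>2 \<le> q\<^sup>n P Q\<close> for
  \<open>|q| \<ge> 1\<close>. So a real root of \<open>P\<close> would be a root of \<open>Q\<close>, and \<open>Q\<close> vanishes at \<open>-1\<close>.\<close>

section \<open>Elimination systems\<close>

text \<open>The estimates are made at real points, where \<open>V\<close> may be singular and the
  series \<open>u\<close> need not converge. So \<open>V u = 1\<close> is cleared of denominators:
  integer polynomials \<open>p N\<close> and \<open>d\<close> with \<open>d(0) = 1\<close> satisfy
  \<open>V p = d\<close> in every row. As \<open>V\<close> is the identity at \<open>q = 0\<close>,
  its series solution is unique, which gives \<open>u = p / d\<close>; the inequalities are then
  statements about values of \<open>p N\<close> and \<open>d\<close>.

  The sum of the \<open>p N\<close> and \<open>d\<close> may have a common factor vanishing at the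
  point of interest. The inequalities therefore reach the reduced \<open>P\<close> and
  \<open>Q\<close> by a limit along nearby points. A common real root is impossible because some
  nonzero integer is a polynomial combination of \<open>P\<close> and \<open>Q\<close>; the same
  fact keeps \<open>P\<close> nonzero at \<open>-1\<close>, where \<open>Q\<close> vanishes.

  The combinatorial obstacle is that cutting a circuit down to its part outside a set
  \<open>S\<close>, as contractions and initial systems do, may erase the circuit that elimination
  has produced. Initial systems and the lifting of covectors both rest on an elimination whose
  result is sure to leave \<open>S\<close>.\<close>

text \<open>Incomparability of supports is not required, so that contractions and initial systems need
  not be reduced to their minimal members.\<close>

definition elim_system :: "('a set \<times> 'a set) set \<Rightarrow> bool" where
  "elim_system \<C> \<longleftrightarrow>
     (\<forall>X\<in>\<C>. fst X \<inter> snd X = {} \<and> supp X \<noteq> {} \<and> prod.swap X \<in> \<C>) \<and>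
     (\<forall>X\<in>\<C>. \<forall>Y\<in>\<C>. \<forall>e. X \<noteq> prod.swap Y \<and> e \<in> fst X \<inter> snd Y \<longrightarrow>
        (\<exists>Z\<in>\<C>. fst Z \<subseteq> (fst X \<union> fst Y) - {e} \<and> snd Z \<subseteq> (snd X \<union> snd Y) - {e}))"

definition contr :: "'a set \<Rightarrow> ('a set \<times> 'a set) set \<Rightarrow> ('a set \<times> 'a set) set" where
  "contr S \<C> = (\<lambda>X. (fst X - S, snd X - S)) ` {X \<in> \<C>. \<not> supp X \<subseteq> S}"

definition free :: "('a set \<times> 'a set) set \<Rightarrow> 'a set \<Rightarrow> bool" where
  "free \<C> B \<longleftrightarrow> (\<forall>X\<in>\<C>. \<not> supp X \<subseteq> B)"

definition basis_of :: "('a set \<times> 'a set) set \<Rightarrow> 'a set \<Rightarrow> 'a set \<Rightarrow> bool" where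
  "basis_of \<C> S B \<longleftrightarrow>
     B \<subseteq> S \<and> free \<C> B \<and> (\<forall>s\<in>S - B. \<exists>X\<in>\<C>. supp X \<subseteq> insert s B)"

lemma supp_swap [simp]: "supp (prod.swap X) = supp X"
  by (auto simp: supp_def)

lemma eq_swap_iff: "X = prod.swap Y \<longleftrightarrow> fst X = snd Y \<and> snd X = fst Y"
  by (cases X; cases Y) auto

lemma elim_systemD:
  assumes "elim_system \<C>" "X \<in> \<C>"
  shows "fst X \<inter> snd X = {}" "supp X \<noteq> {}" "prod.swap X \<in> \<C>"
  using assms by (auto simp: elim_system_def)

lemma elim_system_elim:
  assumes "elim_system \<C>" "X \<in> \<C>" "Y \<in> \<C>" "X \<noteq> prod.swap Y" "e \<in> fst X" "e \<in> snd Y"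
  obtains Z where "Z \<in> \<C>" "fst Z \<subseteq> (fst X \<union> fst Y) - {e}" "snd Z \<subseteq> (snd X \<union> snd Y) - {e}"
proof -
  have "\<forall>X\<in>\<C>. \<forall>Y\<in>\<C>. \<forall>e. X \<noteq> prod.swap Y \<and> e \<in> fst X \<inter> snd Y \<longrightarrow>
      (\<exists>Z\<in>\<C>. fst Z \<subseteq> (fst X \<union> fst Y) - {e} \<and> snd Z \<subseteq> (snd X \<union> snd Y) - {e})"
    using assms(1) unfolding elim_system_def by (elim conjE)
  from spec[OF bspec[OF bspec[OF this assms(2)] assms(3)], of e]
  have "\<exists>Z\<in>\<C>. fst Z \<subseteq> (fst X \<union> fst Y) - {e} \<and> snd Z \<subseteq> (snd X \<union> snd Y) - {e}"
    using assms(4-6) by simp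
  then show thesis using that by (elim bexE conjE)
qed

text \<open>Only the signs of \<open>X\<close> are tracked. Either \<open>Y\<close> or its opposite
  has the sign at \<open>e\<close> opposite to that of \<open>X\<close>, and different supports rule
  out the excluded pair of opposite circuits.\<close>

lemma elim_system_elim_supp:
  assumes es: "elim_system \<C>" and X: "X \<in> \<C>" and Y: "Y \<in> \<C>" and ne: "supp X \<noteq> supp Y"
    and e: "e \<in> supp X" "e \<in> supp Y"
  obtains Z where "Z \<in> \<C>" "fst Z \<subseteq> (fst X \<union> supp Y) - {e}" "snd Z \<subseteq> (snd X \<union> supp Y) - {e}"
proof -
  define Y' where "Y' = (if e \<in> fst X \<longleftrightarrow> e \<in> snd Y then Y else prod.swap Y)"
  have Y': "Y' \<in> \<C>" "supp Y' = supp Y" "e \<in> supp Y'"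
    using Y e elim_systemD(3)[OF es Y] by (auto simp: Y'_def)
  have ne': "X \<noteq> prod.swap Y'" "Y' \<noteq> prod.swap X"
    using ne Y'(2) by (metis supp_swap)+
  have "e \<in> fst X \<and> e \<in> snd Y' \<or> e \<in> fst Y' \<and> e \<in> snd X"
  proof (cases "e \<in> fst X \<longleftrightarrow> e \<in> snd Y")
    case True
    then have "Y' = Y" by (simp add: Y'_def)
    then show ?thesis using True e unfolding supp_def by blast
  next
    case False
    then have "snd Y' = fst Y" "fst Y' = snd Y" by (simp_all add: Y'_def)
    then show ?thesis using False e unfolding supp_def by blast
  qed
  then consider "e \<in> fst X" "e \<in> snd Y'" | "e \<in> fst Y'" "e \<in> snd X" by blast
  then show ?thesis
  proof cases
    case 1
    from elim_system_elim[OF es X Y'(1) ne'(1) 1] obtain Z where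
      "Z \<in> \<C>" "fst Z \<subseteq> (fst X \<union> fst Y') - {e}" "snd Z \<subseteq> (snd X \<union> snd Y') - {e}" .
    with that[of Z] Y'(2) show ?thesis unfolding supp_def by blast
  next
    case 2
    from elim_system_elim[OF es Y'(1) X ne'(2) 2] obtain Z where
      "Z \<in> \<C>" "fst Z \<subseteq> (fst Y' \<union> fst X) - {e}" "snd Z \<subseteq> (snd Y' \<union> snd X) - {e}" .
    with that[of Z] Y'(2) show ?thesis unfolding supp_def by blast
  qed
qed

section \<open>Bases of a subset and their exchange\<close>

lemma basis_ofD:
  assumes "basis_of \<C> S B"
  shows "B \<subseteq> S" "free \<C> B" "X \<in> \<C> \<Longrightarrow> \<not> supp X \<subseteq> B"
    "s \<in> S \<Longrightarrow> s \<notin> B \<Longrightarrow> \<exists>X\<in>\<C>. supp X \<subseteq> insert s B"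
  using assms unfolding basis_of_def free_def by simp_all

lemma basis_of_extend:
  assumes "finite S" "I \<subseteq> S" "free \<C> I"
  obtains B where "I \<subseteq> B" "basis_of \<C> S B"
proof -
  define P where "P B \<longleftrightarrow> I \<subseteq> B \<and> B \<subseteq> S \<and> free \<C> B" for B
  have "P I" using assms by (simp add: P_def)
  moreover have "\<forall>B. P B \<longrightarrow> card B \<le> card S" using assms(1) by (auto simp: P_def card_mono)
  moreover from calculation have "\<forall>B. P B \<longrightarrow> card B < Suc (card S)" by auto
  ultimately obtain B where B: "P B" "\<And>B'. P B' \<Longrightarrow> card B' \<le> card B"
    using ex_has_greatest_nat[of P I card "Suc (card S)"] by blast
  have "\<exists>X\<in>\<C>. supp X \<subseteq> insert s B" if s: "s \<in> S - B" for s
  proof (rule ccontr)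
    assume "\<not> ?thesis"
    then have "P (insert s B)" using s B(1) by (auto simp: P_def free_def)
    moreover have "finite B" using B(1) assms(1) by (auto simp: P_def finite_subset)
    ultimately show False using B(2)[of "insert s B"] s by simp
  qed
  then have "basis_of \<C> S B" using B(1) unfolding P_def basis_of_def by blast
  with B(1) that[of B] show ?thesis unfolding P_def by blast
qed

text \<open>A circuit joining \<open>b\<close> to \<open>B'\<close> cannot lie inside the free set
  \<open>B\<close>, so it contains some \<open>e\<close> of \<open>B' - B\<close>. Eliminating
  \<open>b\<close> against it would turn a circuit inside the new set into one inside
  \<open>B'\<close>; eliminating \<open>e\<close> turns a dependence over \<open>B'\<close> into one
  over the new set.\<close>

lemma basis_of_exchange:
  assumes es: "elim_system \<C>" and B: "basis_of \<C> S B" and B': "basis_of \<C> S B'"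
    and b: "b \<in> B - B'"
  obtains C e where "C \<in> \<C>" "supp C \<subseteq> insert b B'" "e \<in> supp C" "e \<in> B' - B"
    "basis_of \<C> S (insert b (B' - {e}))"
proof -
  obtain C where C: "C \<in> \<C>" "supp C \<subseteq> insert b B'"
    using b basis_ofD(1)[OF B] basis_ofD(4)[OF B', of b] by blast
  have bC: "b \<in> supp C" using C basis_ofD(3)[OF B'] by blast
  obtain e where e: "e \<in> supp C" "e \<notin> B"
    using basis_ofD(3)[OF B C(1)] by blast
  have eB': "e \<in> B'" "e \<noteq> b" using e C(2) b by auto
  let ?B = "insert b (B' - {e})"
  have "\<not> supp D \<subseteq> ?B" if D: "D \<in> \<C>" for D
  proof
    assume sub: "supp D \<subseteq> ?B"
    have "b \<in> supp D" using sub basis_ofD(3)[OF B' D] by blast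
    moreover have "supp D \<noteq> supp C" using sub e eB' by auto
    ultimately obtain Z where "Z \<in> \<C>" "fst Z \<subseteq> (fst D \<union> supp C) - {b}" "snd Z \<subseteq> (snd D \<union> supp C) - {b}"
      using elim_system_elim_supp[OF es D C(1)] bC by metis
    then have "Z \<in> \<C>" "supp Z \<subseteq> B'" using sub C(2) by (auto simp: supp_def)
    then show False using basis_ofD(3)[OF B'] by blast
  qed
  moreover have "\<exists>D\<in>\<C>. supp D \<subseteq> insert s ?B" if s: "s \<in> S - ?B" for s
  proof (cases "s = e")
    case True
    then show ?thesis using C by blast
  next
    case False
    then have "s \<in> S - B'" using s by auto
    then obtain D where D: "D \<in> \<C>" "supp D \<subseteq> insert s B'"
      using basis_ofD(4)[OF B', of s] by blast
    show ?thesis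
    proof (cases "e \<in> supp D")
      case False
      then show ?thesis using D by blast
    next
      case True
      have "supp D \<noteq> supp C" using D bC s b by auto
      then obtain Z where "Z \<in> \<C>" "fst Z \<subseteq> (fst D \<union> supp C) - {e}" "snd Z \<subseteq> (snd D \<union> supp C) - {e}"
        using elim_system_elim_supp[OF es D(1) C(1) _ True e(1)] by metis
      moreover from this have "supp Z \<subseteq> insert s ?B"
        using D(2) C(2) by (auto simp: supp_def)
      ultimately show ?thesis by blast
    qed
  qed
  moreover have "?B \<subseteq> S" using basis_ofD(1)[OF B] basis_ofD(1)[OF B'] b by blast
  ultimately have "basis_of \<C> S ?B" unfolding basis_of_def free_def by blast
  with that[OF C e(1)] e eB' show ?thesis by blast
qed

text \<open>Each step exchanges some \<open>e\<close> of \<open>B'\<close> for some \<open>b\<close>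
  of \<open>B\<close>, which decreases \<open>card (B - B')\<close>. The circuit of the exchange
  lies in \<open>S\<close>, so eliminating \<open>e\<close> against it adds nothing to
  \<open>X\<close> outside \<open>S\<close>. The result still leaves \<open>S\<close>, because its
  part in \<open>S\<close> stays inside a free set.\<close>

lemma circuit_reduce_to_basis:
  assumes es: "elim_system \<C>" and fin: "finite S" and B: "basis_of \<C> S B"
  shows "basis_of \<C> S B' \<Longrightarrow> X \<in> \<C> \<Longrightarrow> \<not> supp X \<subseteq> S \<Longrightarrow> supp X \<inter> S \<subseteq> B' \<Longrightarrow>
    \<exists>Y\<in>\<C>. \<not> supp Y \<subseteq> S \<and> fst Y - S \<subseteq> fst X \<and> snd Y - S \<subseteq> snd X \<and> supp Y \<inter> S \<subseteq> B"
proof (induction "card (B - B')" arbitrary: B' X rule: less_induct)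
  case less
  show ?case
  proof (cases "B \<subseteq> B'")
    case True
    have "B' \<subseteq> B"
    proof
      fix s assume s: "s \<in> B'"
      show "s \<in> B"
      proof (rule ccontr)
        assume "s \<notin> B"
        then obtain D where "D \<in> \<C>" "supp D \<subseteq> insert s B"
          using basis_ofD(4)[OF B, of s] basis_ofD(1)[OF less.prems(1)] s by blast
        then show False using True s basis_ofD(3)[OF less.prems(1)] by blast
      qed
    qed
    with less.prems show ?thesis by blast
  next
    case False
    then obtain b where b: "b \<in> B - B'" by auto
    obtain C e where C: "C \<in> \<C>" "supp C \<subseteq> insert b B'" "e \<in> supp C" "e \<in> B' - B"
      and B'': "basis_of \<C> S (insert b (B' - {e}))"
      using basis_of_exchange[OF es B less.prems(1) b] .
    let ?B = "insert b (B' - {e})"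
    have "finite B" using basis_ofD(1)[OF B] fin finite_subset by blast
    moreover have "B - ?B = (B - B') - {b}" using C(4) by auto
    ultimately have less': "card (B - ?B) < card (B - B')"
      using b by (metis card_Diff1_less finite_Diff)
    have CS: "supp C \<subseteq> S" using C(2) basis_ofD(1)[OF less.prems(1)] basis_ofD(1)[OF B] b by blast
    have "\<exists>Z\<in>\<C>. \<not> supp Z \<subseteq> S \<and> fst Z - S \<subseteq> fst X \<and> snd Z - S \<subseteq> snd X \<and> supp Z \<inter> S \<subseteq> ?B"
    proof (cases "e \<in> supp X")
      case False
      then show ?thesis using less.prems(2-4) by blast
    next
      case True
      have "supp X \<noteq> supp C" using CS less.prems(3) by auto
      then obtain Z where Z: "Z \<in> \<C>" "fst Z \<subseteq> (fst X \<union> supp C) - {e}" "snd Z \<subseteq> (snd X \<union> supp C) - {e}"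
        using elim_system_elim_supp[OF es less.prems(2) C(1) _ True C(3)] by metis
      have "supp Z \<inter> S \<subseteq> ?B" using Z(2,3) C(2) less.prems(4) by (auto simp: supp_def)
      moreover have "\<not> supp Z \<subseteq> ?B" using basis_ofD(3)[OF B'' Z(1)] .
      ultimately show ?thesis using Z CS by blast
    qed
    then obtain Z where Z: "Z \<in> \<C>" "\<not> supp Z \<subseteq> S" "fst Z - S \<subseteq> fst X" "snd Z - S \<subseteq> snd X"
      "supp Z \<inter> S \<subseteq> ?B" by blast
    from less.hyps[OF less' B'' Z(1,2,5)]
    obtain Y where Y: "Y \<in> \<C>" "\<not> supp Y \<subseteq> S" "fst Y - S \<subseteq> fst Z" "snd Y - S \<subseteq> snd Z"
      "supp Y \<inter> S \<subseteq> B" by (elim bexE conjE)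
    have "fst Y - S \<subseteq> fst X" "snd Y - S \<subseteq> snd X" using Y(3,4) Z(3,4) by auto
    with Y(1,2,5) show ?thesis by blast
  qed
qed

lemma oriented_matroid_imp_elim_system:
  assumes "oriented_matroid E \<C>"
  shows "elim_system \<C>"
  unfolding elim_system_def
proof (intro conjI)
  have *: "\<forall>X\<in>\<C>. supp X \<subseteq> E \<and> fst X \<inter> snd X = {}" "({}, {}) \<notin> \<C>"
    "\<forall>X\<in>\<C>. prod.swap X \<in> \<C>"
    using assms unfolding oriented_matroid_def by simp_all
  have "supp X \<noteq> {}" if "X \<in> \<C>" for X
    using *(2) that by (cases X) (auto simp: supp_def)
  with * show "\<forall>X\<in>\<C>. fst X \<inter> snd X = {} \<and> supp X \<noteq> {} \<and> prod.swap X \<in> \<C>"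
    by simp
  show "\<forall>X\<in>\<C>. \<forall>Y\<in>\<C>. \<forall>e. X \<noteq> prod.swap Y \<and> e \<in> fst X \<inter> snd Y \<longrightarrow>
      (\<exists>Z\<in>\<C>. fst Z \<subseteq> (fst X \<union> fst Y) - {e} \<and> snd Z \<subseteq> (snd X \<union> snd Y) - {e})"
    using assms unfolding oriented_matroid_def by (elim conjE)
qed

lemma oriented_matroid_minimal:
  assumes "oriented_matroid E \<C>" "X \<in> \<C>" "Y \<in> \<C>" "supp X \<subseteq> supp Y"
  shows "supp X = supp Y"
proof -
  have "\<forall>X\<in>\<C>. \<forall>Y\<in>\<C>. supp X \<subseteq> supp Y \<longrightarrow> X = Y \<or> X = prod.swap Y"
    using assms(1) unfolding oriented_matroid_def by (elim conjE)
  then have "X = Y \<or> X = prod.swap Y" using assms(2-4) by blast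
  then show ?thesis by (metis supp_swap)
qed

text \<open>Weak elimination followed by contraction could produce a circuit that vanishes outside \<open>S\<close>.
  This is avoided by first moving one of the two circuits so that both meet \<open>S\<close> inside one
  common basis of \<open>S\<close>.\<close>

lemma elim_outside:
  assumes om: "oriented_matroid E \<C>" and fin: "finite S" and X: "X \<in> \<C>" and Y: "Y \<in> \<C>"
    and e: "e \<in> fst X" "e \<in> snd Y" "e \<notin> S"
    and ne: "\<not> (fst Y - S = snd X - S \<and> snd Y - S = fst X - S)"
  obtains Z where "Z \<in> \<C>" "\<not> supp Z \<subseteq> S" "fst Z - S \<subseteq> (fst X \<union> fst Y) - {e}"
    "snd Z - S \<subseteq> (snd X \<union> snd Y) - {e}"
proof -
  note found = that
  note es = oriented_matroid_imp_elim_system[OF om]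
  have disj: "fst U \<inter> snd U = {}" if "U \<in> \<C>" for U
    using elim_systemD(1)[OF es that] .
  have indep: "free \<C> (supp U \<inter> S)" if "U \<in> \<C>" "e \<in> supp U" for U
    unfolding free_def using oriented_matroid_minimal[OF om _ that(1)] that(2) e(3) by blast
  have eS: "e \<in> supp X" "e \<in> supp Y" "\<not> supp X \<subseteq> S" "\<not> supp Y \<subseteq> S"
    using e unfolding supp_def by blast+
  obtain B where B: "supp X \<inter> S \<subseteq> B" "basis_of \<C> S B"
    using basis_of_extend[OF fin Int_lower2 indep[OF X eS(1)]] .
  obtain B' where B': "supp Y \<inter> S \<subseteq> B'" "basis_of \<C> S B'"
    using basis_of_extend[OF fin Int_lower2 indep[OF Y eS(2)]] .
  have finish: thesis
    if U: "U \<in> \<C>" "fst U - S \<subseteq> fst X" "snd U - S \<subseteq> snd X"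
      and V: "V \<in> \<C>" "fst V - S \<subseteq> fst Y" "snd V - S \<subseteq> snd Y"
      and e': "e \<in> fst U" "e \<in> snd V" and ne': "U \<noteq> prod.swap V"
      and D: "basis_of \<C> S D" "supp U \<inter> S \<subseteq> D" "supp V \<inter> S \<subseteq> D" for U V D
  proof -
    obtain Z where Z: "Z \<in> \<C>" "fst Z \<subseteq> (fst U \<union> fst V) - {e}" "snd Z \<subseteq> (snd U \<union> snd V) - {e}"
      using elim_system_elim[OF es U(1) V(1) ne' e'] .
    have "supp Z \<inter> S \<subseteq> D" using Z(2,3) D(2,3) unfolding supp_def by blast
    then have "\<not> supp Z \<subseteq> S" using basis_ofD(3)[OF D(1) Z(1)] by blast
    then show thesis
      using found[of Z] Z U(2,3) V(2,3) by blast
  qed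
  obtain Y' where Y': "Y' \<in> \<C>" "\<not> supp Y' \<subseteq> S" "fst Y' - S \<subseteq> fst Y" "snd Y' - S \<subseteq> snd Y"
    "supp Y' \<inter> S \<subseteq> B"
    using circuit_reduce_to_basis[OF es fin B(2) B'(2) Y eS(4) B'(1)] by blast
  obtain X' where X': "X' \<in> \<C>" "\<not> supp X' \<subseteq> S" "fst X' - S \<subseteq> fst X" "snd X' - S \<subseteq> snd X"
    "supp X' \<inter> S \<subseteq> B'"
    using circuit_reduce_to_basis[OF es fin B'(2) B(2) X eS(3) B(1)] by blast
  \<comment> \<open>A replacement that has lost \<open>e\<close> is already the desired circuit.
    Otherwise there are two candidate pairs for elimination: \<open>X\<close> with
    \<open>Y'\<close>, which share the basis \<open>B\<close>, and \<open>X'\<close> with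
    \<open>Y\<close>, which share \<open>B'\<close>.\<close>
  consider "e \<notin> supp Y'" | "e \<notin> supp X'" | "e \<in> supp X'" "e \<in> supp Y'" by blast
  then show thesis
  proof cases
    case 1
    then show thesis using that[OF Y'(1,2)] Y'(3,4) by (auto simp: supp_def)
  next
    case 2
    then show thesis using that[OF X'(1,2)] X'(3,4) by (auto simp: supp_def)
  next
    case 3
    have eY': "e \<in> snd Y'" using 3(2) Y'(3) e disj[OF Y] by (auto simp: supp_def)
    have eX': "e \<in> fst X'" using 3(1) X'(4) e disj[OF X] by (auto simp: supp_def)
    \<comment> \<open>If both pairs were opposite, the inclusions outside \<open>S\<close> would
      make \<open>X\<close> and \<open>Y\<close> opposite there, which \<open>ne\<close>
      excludes.\<close>
    have "X \<noteq> prod.swap Y' \<or> X' \<noteq> prod.swap Y"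
    proof (rule ccontr)
      assume "\<not> ?thesis"
      then have "fst X = snd Y'" "snd X = fst Y'" "fst X' = snd Y" "snd X' = fst Y"
        by (simp_all add: eq_swap_iff)
      then show False using ne X'(3,4) Y'(3,4) by blast
    qed
    then show thesis
    proof
      assume "X \<noteq> prod.swap Y'"
      then show thesis
        by (intro finish[of X Y' B]) (use X Y' B e eY' in auto)
    next
      assume "X' \<noteq> prod.swap Y"
      then show thesis
        by (intro finish[of X' Y B']) (use Y X' B' e eX' in auto)
    qed
  qed
qed

section \<open>Counting topes\<close>

text \<open>A sign vector without zeros is given by the set \<open>N\<close> of its negative entries.\<close>

definition conforms :: "'a set \<Rightarrow> 'a set \<times> 'a set \<Rightarrow> bool" where
  "conforms N X \<longleftrightarrow> fst X \<inter> N = {} \<and> snd X \<subseteq> N"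

text \<open>Orthogonality to a circuit means agreement somewhere and disagreement somewhere. In an
  elimination system circuits come in opposite pairs, so excluding full agreement is enough.\<close>

definition topes :: "'a set \<Rightarrow> ('a set \<times> 'a set) set \<Rightarrow> 'a set set" where
  "topes E \<C> = {N. N \<subseteq> E \<and> (\<forall>X\<in>\<C>. \<not> conforms N X)}"

text \<open>Only the increments of the rank are prescribed. Without the normalisation
  \<open>r {} = 0\<close>, a contraction is represented by \<open>r (insert e S)\<close> as it
  stands; this is the origin of the sign \<open>(-1) ^ r {}\<close> in
  \<open>card_topes\<close>.\<close>

definition represents :: "('a set \<times> 'a set) set \<Rightarrow> 'a set \<Rightarrow> ('a set \<Rightarrow> nat) \<Rightarrow> bool" where
  "represents \<C> E r \<longleftrightarrow>
     (\<forall>S\<subseteq>E. \<forall>e\<in>E - S. r (insert e S) =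
        r S + (if \<exists>X\<in>\<C>. e \<in> supp X \<and> supp X \<subseteq> insert e S then 0 else 1))"

lemma representsD:
  assumes "represents \<C> E r" "S \<subseteq> E" "e \<in> E" "e \<notin> S"
  shows "r (insert e S) = r S + (if \<exists>X\<in>\<C>. e \<in> supp X \<and> supp X \<subseteq> insert e S then 0 else 1)"
  using assms(1)[unfolded represents_def, rule_format, of S e] assms(2-) by simp

lemma sum_Pow_insert:
  assumes "finite E" "e \<notin> E"
  shows "(\<Sum>S\<in>Pow (insert e E). f S) = (\<Sum>S\<in>Pow E. f S + f (insert e S))"
proof -
  have "inj_on (insert e) (Pow E)" using assms(2) by (auto simp: inj_on_def)
  moreover have "Pow E \<inter> insert e ` Pow E = {}" using assms(2) by auto
  ultimately show ?thesis
    using assms(1) by (simp add: Pow_insert sum.union_disjoint sum.reindex sum.distrib)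
qed

lemma elim_system_delete:
  assumes "elim_system \<C>"
  shows "elim_system {X \<in> \<C>. e \<notin> supp X}"
  unfolding elim_system_def
proof (intro conjI ballI allI impI)
  fix X assume X: "X \<in> {X \<in> \<C>. e \<notin> supp X}"
  then show "fst X \<inter> snd X = {}" "supp X \<noteq> {}" "prod.swap X \<in> {X \<in> \<C>. e \<notin> supp X}"
    using elim_systemD[OF assms, of X] by auto
  fix Y f assume Y: "Y \<in> {X \<in> \<C>. e \<notin> supp X}" and f: "X \<noteq> prod.swap Y \<and> f \<in> fst X \<inter> snd Y"
  then obtain Z where Z: "Z \<in> \<C>" "fst Z \<subseteq> (fst X \<union> fst Y) - {f}" "snd Z \<subseteq> (snd X \<union> snd Y) - {f}"
    using elim_system_elim[OF assms, of X Y f] X by blast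
  then have "e \<notin> supp Z" using X Y by (auto simp: supp_def)
  then show "\<exists>Z\<in>{X \<in> \<C>. e \<notin> supp X}. fst Z \<subseteq> (fst X \<union> fst Y) - {f} \<and> snd Z \<subseteq> (snd X \<union> snd Y) - {f}"
    using Z by blast
qed

lemma elim_system_contr_nonloop:
  assumes es: "elim_system \<C>" and nl: "\<And>X. X \<in> \<C> \<Longrightarrow> \<not> supp X \<subseteq> {e}"
  shows "elim_system (contr {e} \<C>)"
  unfolding elim_system_def
proof (intro conjI ballI allI impI)
  fix U assume "U \<in> contr {e} \<C>"
  then obtain X where X: "X \<in> \<C>" "U = (fst X - {e}, snd X - {e})"
    by (auto simp: contr_def)
  show "fst U \<inter> snd U = {}" using X elim_systemD(1)[OF es X(1)] by auto
  show "supp U \<noteq> {}" using X nl[OF X(1)] by (auto simp: supp_def)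
  show "prod.swap U \<in> contr {e} \<C>"
    using X elim_systemD(3)[OF es X(1)] nl[OF X(1)] unfolding contr_def
    by (intro image_eqI[of _ _ "prod.swap X"]) (auto simp: supp_def)
  fix V f assume "V \<in> contr {e} \<C>" and ne: "U \<noteq> prod.swap V \<and> f \<in> fst U \<inter> snd V"
  then obtain Y where Y: "Y \<in> \<C>" "V = (fst Y - {e}, snd Y - {e})"
    by (auto simp: contr_def)
  have "X \<noteq> prod.swap Y" "f \<in> fst X" "f \<in> snd Y"
    using ne X(2) Y(2) by (auto simp: eq_swap_iff)
  then obtain Z where Z: "Z \<in> \<C>" "fst Z \<subseteq> (fst X \<union> fst Y) - {f}" "snd Z \<subseteq> (snd X \<union> snd Y) - {f}"
    using elim_system_elim[OF es X(1) Y(1)] by blast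
  show "\<exists>Z\<in>contr {e} \<C>. fst Z \<subseteq> (fst U \<union> fst V) - {f} \<and> snd Z \<subseteq> (snd U \<union> snd V) - {f}"
    by (rule bexI[of _ "(fst Z - {e}, snd Z - {e})"])
      (use Z X(2) Y(2) nl[OF Z(1)] in \<open>auto simp: contr_def\<close>)
qed

text \<open>If neither sign at \<open>e\<close> extends \<open>N\<close>, the two conforming
  circuits have opposite signs at \<open>e\<close>, and eliminating \<open>e\<close> leaves a
  circuit of the deletion that conforms to \<open>N\<close>. For the contraction, a circuit stripped
  of \<open>e\<close> conforms to \<open>N\<close> exactly if the circuit conforms to one of the two
  extensions.\<close>

lemma tope_lift:
  assumes es: "elim_system \<C>" and nl: "\<And>X. X \<in> \<C> \<Longrightarrow> \<not> supp X \<subseteq> {e}" and e: "e \<notin> E"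
  shows "topes E {X \<in> \<C>. e \<notin> supp X} =
      {N \<in> Pow E. N \<in> topes (insert e E) \<C>} \<union> {N \<in> Pow E. insert e N \<in> topes (insert e E) \<C>}"
    (is "?D = ?A \<union> ?B")
    and "topes E (contr {e} \<C>) =
      {N \<in> Pow E. N \<in> topes (insert e E) \<C>} \<inter> {N \<in> Pow E. insert e N \<in> topes (insert e E) \<C>}"
    (is "?C = _")
proof -
  have conf_del: "conforms (insert e N) X \<longleftrightarrow> conforms N X" if "e \<notin> supp X" for N X
    using that by (auto simp: conforms_def supp_def)
  show "?D = ?A \<union> ?B"
  proof (intro equalityI subsetI)
    fix N assume N: "N \<in> ?D"
    then have NE: "N \<subseteq> E" "e \<notin> N" using e by (auto simp: topes_def)
    show "N \<in> ?A \<union> ?B"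
    proof (rule ccontr)
      assume "N \<notin> ?A \<union> ?B"
      then obtain X Y where X: "X \<in> \<C>" "conforms N X" and Y: "Y \<in> \<C>" "conforms (insert e N) Y"
        using NE by (auto simp: topes_def)
      have "e \<in> supp X" using N X unfolding topes_def by blast
      then have eX: "e \<in> fst X" using X(2) NE by (auto simp: conforms_def supp_def)
      have "e \<in> supp Y" using N Y conf_del[of Y N] unfolding topes_def by blast
      then have eY: "e \<in> snd Y" using Y(2) by (auto simp: conforms_def supp_def)
      have "X \<noteq> prod.swap Y"
      proof
        assume "X = prod.swap Y"
        then have "fst X = snd Y" "snd X = fst Y" by (auto simp: eq_swap_iff)
        then have "supp X \<subseteq> {e}" using X(2) Y(2) by (auto simp: conforms_def supp_def)
        then show False using nl[OF X(1)] by simp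
      qed
      then obtain Z where Z: "Z \<in> \<C>" "fst Z \<subseteq> (fst X \<union> fst Y) - {e}" "snd Z \<subseteq> (snd X \<union> snd Y) - {e}"
        using elim_system_elim[OF es X(1) Y(1) _ eX eY] by blast
      then have "e \<notin> supp Z" "conforms N Z"
        using X(2) Y(2) by (auto simp: conforms_def supp_def)
      then show False using N Z(1) unfolding topes_def by blast
    qed
  next
    fix N assume "N \<in> ?A \<union> ?B"
    then show "N \<in> ?D" using conf_del by (auto simp: topes_def)
  qed
  have conf_contr: "conforms N (fst X - {e}, snd X - {e}) \<longleftrightarrow> conforms N X \<or> conforms (insert e N) X"
    if "e \<notin> N" "X \<in> \<C>" for N X
    using that elim_systemD(1)[OF es that(2)] by (auto simp: conforms_def)
  show "?C = ?A \<inter> ?B"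
  proof (intro equalityI subsetI)
    fix N assume N: "N \<in> ?C"
    then have NE: "N \<subseteq> E" "e \<notin> N" using e by (auto simp: topes_def)
    have "\<not> conforms N X \<and> \<not> conforms (insert e N) X" if "X \<in> \<C>" for X
      using N conf_contr[OF NE(2) that] nl[OF that] that by (auto simp: topes_def contr_def)
    then show "N \<in> ?A \<inter> ?B" using NE by (auto simp: topes_def)
  next
    fix N assume N: "N \<in> ?A \<inter> ?B"
    then have NE: "N \<subseteq> E" "e \<notin> N" using e by auto
    show "N \<in> ?C"
      using N conf_contr[OF NE(2)] NE by (auto simp: topes_def contr_def)
  qed
qed

text \<open>Every tope of the deletion extends in one or two ways, and those that extend in both
  ways are the topes of the contraction.\<close>

lemma card_topes_insert:
  assumes es: "elim_system \<C>" and nl: "\<And>X. X \<in> \<C> \<Longrightarrow> \<not> supp X \<subseteq> {e}"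
    and e: "e \<notin> E" and fin: "finite E"
  shows "card (topes (insert e E) \<C>) =
    card (topes E {X \<in> \<C>. e \<notin> supp X}) + card (topes E (contr {e} \<C>))"
proof -
  let ?A = "{N \<in> Pow E. N \<in> topes (insert e E) \<C>}"
  let ?B = "{N \<in> Pow E. insert e N \<in> topes (insert e E) \<C>}"
  have "topes (insert e E) \<C> \<subseteq> ?A \<union> insert e ` ?B"
  proof
    fix N assume N: "N \<in> topes (insert e E) \<C>"
    show "N \<in> ?A \<union> insert e ` ?B"
    proof (cases "e \<in> N")
      case True
      then have "N = insert e (N - {e})" by auto
      moreover have "N - {e} \<in> ?B" using N True by (auto simp: topes_def insert_absorb)
      ultimately show ?thesis by blast
    next
      case False
      then show ?thesis using N by (auto simp: topes_def)
    qed
  qed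
  then have "topes (insert e E) \<C> = ?A \<union> insert e ` ?B" by blast
  moreover have "?A \<inter> insert e ` ?B = {}" using e by auto
  moreover have "card (insert e ` ?B) = card ?B"
    using e by (intro card_image) (auto simp: inj_on_def)
  moreover have "finite ?A" "finite ?B" using fin by auto
  ultimately have "card (topes (insert e E) \<C>) = card ?A + card ?B"
    by (metis (no_types, lifting) card_Un_disjoint finite_imageI)
  also have "\<dots> = card (?A \<union> ?B) + card (?A \<inter> ?B)"
    using fin by (intro card_Un_Int) auto
  finally show ?thesis using tope_lift[OF es nl e] by simp
qed

lemma represents_delete:
  assumes "represents \<C> (insert e E) r" "e \<notin> E"
  shows "represents {X \<in> \<C>. e \<notin> supp X} E r"
  unfolding represents_def
proof (intro allI impI ballI)
  fix S f assume S: "S \<subseteq> E" "f \<in> E - S"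
  then have "(\<exists>X\<in>{X \<in> \<C>. e \<notin> supp X}. f \<in> supp X \<and> supp X \<subseteq> insert f S) \<longleftrightarrow>
      (\<exists>X\<in>\<C>. f \<in> supp X \<and> supp X \<subseteq> insert f S)"
    using assms(2) by blast
  moreover have "r (insert f S) = r S + (if \<exists>X\<in>\<C>. f \<in> supp X \<and> supp X \<subseteq> insert f S then 0 else 1)"
    using representsD[OF assms(1), of S f] S by blast
  ultimately show "r (insert f S) = r S +
      (if \<exists>X\<in>{X \<in> \<C>. e \<notin> supp X}. f \<in> supp X \<and> supp X \<subseteq> insert f S then 0 else 1)"
    by simp
qed

lemma represents_contr:
  assumes "represents \<C> (insert e E) r" "e \<notin> E"
  shows "represents (contr {e} \<C>) E (\<lambda>S. r (insert e S))"
  unfolding represents_def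
proof (intro allI impI ballI)
  fix S f assume S: "S \<subseteq> E" "f \<in> E - S"
  have fe: "f \<noteq> e" using S assms(2) by auto
  have *: "supp (fst X - {e}, snd X - {e}) = supp X - {e}" for X :: "'a set \<times> 'a set"
    by (auto simp: supp_def)
  have "(\<exists>X\<in>contr {e} \<C>. f \<in> supp X \<and> supp X \<subseteq> insert f S) \<longleftrightarrow>
      (\<exists>X\<in>\<C>. f \<in> supp X \<and> supp X \<subseteq> insert f (insert e S))"
    unfolding contr_def using fe by (auto simp: *)
  moreover have "r (insert f (insert e S)) = r (insert e S) +
      (if \<exists>X\<in>\<C>. f \<in> supp X \<and> supp X \<subseteq> insert f (insert e S) then 0 else 1)"
    using representsD[OF assms(1), of "insert e S" f] S fe by blast
  ultimately show "r (insert e (insert f S)) = r (insert e S) +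
      (if \<exists>X\<in>contr {e} \<C>. f \<in> supp X \<and> supp X \<subseteq> insert f S then 0 else 1)"
    by (simp add: insert_commute)
qed

text \<open>The Las Vergnas count, by deletion and contraction. If \<open>e\<close> is a loop, both
  sides vanish: subsets with and without \<open>e\<close> cancel in pairs, and every
  \<open>N\<close> conforms to one of the two opposite circuits on \<open>e\<close>.\<close>

lemma card_topes:
  assumes "finite E" "elim_system \<C>" "\<And>X. X \<in> \<C> \<Longrightarrow> supp X \<subseteq> E" "represents \<C> E r"
  shows "(\<Sum>S\<in>Pow E. (-1 :: int) ^ (card S + r S)) = (-1) ^ r {} * int (card (topes E \<C>))"
  using assms
proof (induction E arbitrary: \<C> r rule: finite_induct)
  case empty
  then have "\<C> = {}" using elim_systemD(2) by blast
  then have "topes {} \<C> = {{}}" by (auto simp: topes_def)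
  then show ?case by simp
next
  case (insert e E \<C> r)
  have card_ins: "card (insert e S) = Suc (card S)" if "S \<in> Pow E" for S
    using that insert.hyps by (intro card_insert_disjoint) (auto dest: finite_subset)
  have split: "(\<Sum>S\<in>Pow (insert e E). (-1 :: int) ^ (card S + r S)) =
      (\<Sum>S\<in>Pow E. (-1) ^ (card S + r S)) - (\<Sum>S\<in>Pow E. (-1) ^ (card S + r (insert e S)))"
    using insert.hyps by (simp add: sum_Pow_insert sum_subtractf[symmetric] card_ins)
  show ?case
  proof (cases "\<exists>X\<in>\<C>. supp X \<subseteq> {e}")
    case True
    then obtain X where X: "X \<in> \<C>" "supp X \<subseteq> {e}" by blast
    then have eX: "supp X = {e}" using elim_systemD(2)[OF insert.prems(1) X(1)] by auto
    have "r (insert e S) = r S" if S: "S \<in> Pow E" for S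
    proof -
      have "\<exists>X\<in>\<C>. e \<in> supp X \<and> supp X \<subseteq> insert e S" using X(1) eX by auto
      then show ?thesis
        using representsD[OF insert.prems(3), of S e] insert.hyps S by auto
    qed
    then have "(\<Sum>S\<in>Pow (insert e E). (-1 :: int) ^ (card S + r S)) = 0"
      unfolding split by simp
    moreover have "topes (insert e E) \<C> = {}"
    proof -
      have "conforms N X \<or> conforms N (prod.swap X)" for N
        using eX elim_systemD(1)[OF insert.prems(1) X(1)]
        by (cases "e \<in> N"; cases "e \<in> fst X") (auto simp: conforms_def supp_def)
      then show ?thesis
        using elim_systemD(3)[OF insert.prems(1) X(1)] X(1) unfolding topes_def by blast
    qed
    ultimately show ?thesis by simp
  next
    case False
    then have nl: "\<And>X. X \<in> \<C> \<Longrightarrow> \<not> supp X \<subseteq> {e}" by blast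
    have "(\<Sum>S\<in>Pow E. (-1 :: int) ^ (card S + r S)) =
        (-1) ^ r {} * int (card (topes E {X \<in> \<C>. e \<notin> supp X}))"
      using insert.prems(2) represents_delete[OF insert.prems(3) insert.hyps(2)]
      by (intro insert.IH elim_system_delete insert.prems(1)) auto
    moreover have "(\<Sum>S\<in>Pow E. (-1 :: int) ^ (card S + r (insert e S))) =
        (-1) ^ r (insert e {}) * int (card (topes E (contr {e} \<C>)))"
    proof (intro insert.IH[of _ "\<lambda>S. r (insert e S)"] elim_system_contr_nonloop insert.prems(1) nl)
      show "represents (contr {e} \<C>) E (\<lambda>S. r (insert e S))"
        by (rule represents_contr[OF insert.prems(3) insert.hyps(2)])
      fix U assume "U \<in> contr {e} \<C>"
      then show "supp U \<subseteq> E" using insert.prems(2) by (force simp: contr_def supp_def)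
    qed
    moreover have "\<not> (\<exists>X\<in>\<C>. e \<in> supp X \<and> supp X \<subseteq> insert e {})" using nl by blast
    then have "r (insert e {}) = Suc (r {})"
      using representsD[OF insert.prems(3), of "{}" e] by simp
    moreover have "card (topes (insert e E) \<C>) =
        card (topes E {X \<in> \<C>. e \<notin> supp X}) + card (topes E (contr {e} \<C>))"
      by (rule card_topes_insert[OF insert.prems(1) nl insert.hyps(2,1)])
    ultimately show ?thesis unfolding split by (simp add: algebra_simps)
  qed
qed

lemma topes_nonempty:
  assumes "finite E" "elim_system \<C>" "\<And>X. X \<in> \<C> \<Longrightarrow> supp X \<subseteq> E"
    "\<And>X e. X \<in> \<C> \<Longrightarrow> \<not> supp X \<subseteq> {e}"
  shows "topes E \<C> \<noteq> {}"
  using assms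
proof (induction E arbitrary: \<C> rule: finite_induct)
  case empty
  then have "\<C> = {}" using elim_systemD(2) by blast
  then show ?case by (auto simp: topes_def)
next
  case (insert e E \<C>)
  have "topes E {X \<in> \<C>. e \<notin> supp X} \<noteq> {}"
    using insert.prems by (intro insert.IH elim_system_delete) auto
  then show ?case
    using tope_lift(1)[OF insert.prems(1,3) insert.hyps(2)] by blast
qed

section \<open>An Euler relation for the faces of a region\<close>

lemma oriented_matroid_restrict:
  assumes "oriented_matroid E \<C>" "finite E'"
  shows "oriented_matroid E' {X \<in> \<C>. supp X \<subseteq> E'}"
proof -
  note es = oriented_matroid_imp_elim_system[OF assms(1)]
  have "\<exists>Z\<in>{X \<in> \<C>. supp X \<subseteq> E'}. fst Z \<subseteq> (fst X \<union> fst Y) - {e} \<and> snd Z \<subseteq> (snd X \<union> snd Y) - {e}"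
    if X: "X \<in> \<C>" "supp X \<subseteq> E'" and Y: "Y \<in> \<C>" "supp Y \<subseteq> E'"
      and e: "X \<noteq> prod.swap Y" "e \<in> fst X" "e \<in> snd Y" for X Y e
  proof -
    obtain Z where Z: "Z \<in> \<C>" "fst Z \<subseteq> (fst X \<union> fst Y) - {e}" "snd Z \<subseteq> (snd X \<union> snd Y) - {e}"
      using elim_system_elim[OF es X(1) Y(1) e] .
    then have "supp Z \<subseteq> E'" using X(2) Y(2) unfolding supp_def by blast
    with Z show ?thesis by blast
  qed
  moreover have "\<forall>X\<in>\<C>. \<forall>Y\<in>\<C>. supp X \<subseteq> supp Y \<longrightarrow> X = Y \<or> X = prod.swap Y"
    using assms(1) unfolding oriented_matroid_def by (elim conjE)
  moreover have "({}, {}) \<notin> \<C>" using elim_systemD(2)[OF es] by (force simp: supp_def)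
  ultimately show ?thesis
    using elim_systemD(1,3)[OF es] assms(2) unfolding oriented_matroid_def by simp
qed

text \<open>The sign vector in question is zero on \<open>S\<close>, negative on \<open>A - S\<close> and positive on
  \<open>E - A\<close>; since circuits come in opposite pairs, orthogonality need only exclude agreement.\<close>

definition covector :: "('a set \<times> 'a set) set \<Rightarrow> 'a set \<Rightarrow> 'a set \<Rightarrow> 'a set \<Rightarrow> bool" where
  "covector \<C> E A S \<longleftrightarrow> (\<forall>X\<in>\<C>. supp X \<subseteq> E \<and> \<not> supp X \<subseteq> S \<longrightarrow>
     \<not> (fst X \<inter> A \<subseteq> S \<and> snd X \<subseteq> A \<union> S))"

lemma covectorI:
  assumes "\<And>X. X \<in> \<C> \<Longrightarrow> supp X \<subseteq> E \<Longrightarrow> \<not> supp X \<subseteq> S \<Longrightarrow> fst X \<inter> A \<subseteq> S \<Longrightarrow>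
    snd X \<subseteq> A \<union> S \<Longrightarrow> False"
  shows "covector \<C> E A S"
  unfolding covector_def using assms by metis

lemma covectorD:
  assumes "covector \<C> E A S" "X \<in> \<C>" "supp X \<subseteq> E" "\<not> supp X \<subseteq> S" "fst X \<inter> A \<subseteq> S" "snd X \<subseteq> A \<union> S"
  shows False
  using assms(1)[unfolded covector_def] assms(2-) by metis

lemma not_covectorE:
  assumes "\<not> covector \<C> E A S"
  obtains X where "X \<in> \<C>" "supp X \<subseteq> E" "\<not> supp X \<subseteq> S" "fst X \<inter> A \<subseteq> S" "snd X \<subseteq> A \<union> S"
  using assms unfolding covector_def by metis

text \<open>The three terms are the lifts of a covector of the deletion with negative, zero or
  positive entry at \<open>e\<close>. If a circuit joins \<open>e\<close> to \<open>S\<close>, only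
  the zero lift exists and the rank does not change. Otherwise some signed lift exists, and the zero
  lift, of rank one more, exists exactly when both signed lifts do; the total is then
  \<open>1\<close> or \<open>1 - 1 + 1\<close> times the sign of \<open>S\<close>.\<close>

lemma covector_lift:
  assumes om: "oriented_matroid E0 \<C>" and fin: "finite E"
    and rep: "represents \<C> E r" and e: "e \<in> A" and A: "A \<subseteq> E" and S: "S \<subseteq> A - {e}"
  shows "(if covector \<C> E A S then (-1) ^ r S else 0) +
      (if covector \<C> E A (insert e S) then (-1) ^ r (insert e S) else 0) +
      (if covector \<C> E (A - {e}) S then (-1) ^ r S else 0) =
    (if covector \<C> (E - {e}) (A - {e}) S then (-1) ^ r S else (0 :: int))"
proof -
  let ?\<C> = "{X \<in> \<C>. supp X \<subseteq> E}"
  have om': "oriented_matroid E ?\<C>" by (rule oriented_matroid_restrict[OF om fin])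
  note es = oriented_matroid_imp_elim_system[OF om']
  have eES: "e \<in> E" "e \<notin> S" using e A S by auto
  have finS: "finite S" using S A fin by (meson Diff_subset finite_subset subset_trans)
  let ?n = "covector \<C> E A S" and ?z = "covector \<C> E A (insert e S)"
  let ?p = "covector \<C> E (A - {e}) S" and ?d = "covector \<C> (E - {e}) (A - {e}) S"
  have no_e: "fst X \<inter> A = fst X \<inter> (A - {e})" "snd X \<subseteq> A \<union> S \<longleftrightarrow> snd X \<subseteq> (A - {e}) \<union> S"
    "supp X \<subseteq> insert e S \<longleftrightarrow> supp X \<subseteq> S" "supp X \<subseteq> E - {e} \<longleftrightarrow> supp X \<subseteq> E"
    "fst X \<inter> A \<subseteq> insert e S \<longleftrightarrow> fst X \<inter> A \<subseteq> S"
    "snd X \<subseteq> A \<union> insert e S \<longleftrightarrow> snd X \<subseteq> A \<union> S"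
    if "e \<notin> supp X" for X
    using that e by (auto simp: supp_def)
  have up: ?d if npz: "?n \<or> ?z \<or> ?p"
  proof (rule covectorI)
    fix X assume X: "X \<in> \<C>" "supp X \<subseteq> E - {e}" "\<not> supp X \<subseteq> S" "fst X \<inter> (A - {e}) \<subseteq> S"
      "snd X \<subseteq> (A - {e}) \<union> S"
    have "e \<notin> supp X" "supp X \<subseteq> E" using X(2) by auto
    moreover from this have "fst X \<inter> A \<subseteq> S" "snd X \<subseteq> A \<union> S" "\<not> supp X \<subseteq> insert e S"
      using X(3-5) no_e by auto
    ultimately show False
      using npz X covectorD[of \<C> E A S X] covectorD[of \<C> E A "insert e S" X]
        covectorD[of \<C> E "A - {e}" S X] by blast
  qed
  show ?thesis
  proof (cases "\<exists>X\<in>\<C>. e \<in> supp X \<and> supp X \<subseteq> insert e S")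
    case True
    then obtain X where X: "X \<in> ?\<C>" "e \<in> supp X" "supp X \<subseteq> insert e S" using S A eES by blast
    have disjX: "fst X \<inter> snd X = {}" using elim_systemD(1)[OF es X(1)] .
    have swapX: "prod.swap X \<in> ?\<C>" using elim_systemD(3)[OF es X(1)] .
    have r: "r (insert e S) = r S"
      using representsD[OF rep, of S e] True S A eES by auto
    have "\<not> ?n"
    proof
      assume ?n
      then show False
        using covectorD[OF \<open>?n\<close>, of X] covectorD[OF \<open>?n\<close>, of "prod.swap X"] X swapX disjX e eES
        by (cases "e \<in> fst X") (auto simp: supp_def)
    qed
    moreover have "\<not> ?p"
    proof
      assume ?p
      then show False
        using covectorD[OF \<open>?p\<close>, of X] covectorD[OF \<open>?p\<close>, of "prod.swap X"] X swapX disjX e eES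
        by (cases "e \<in> fst X") (auto simp: supp_def)
    qed
    moreover have ?z if d: ?d
    proof (rule covectorI)
      fix Y assume Y: "Y \<in> \<C>" "supp Y \<subseteq> E" "\<not> supp Y \<subseteq> insert e S"
        "fst Y \<inter> A \<subseteq> insert e S" "snd Y \<subseteq> A \<union> insert e S"
      show False
      proof (cases "e \<in> supp Y")
        case False
        then show False using covectorD[OF d, of Y] Y no_e[of Y] by simp
      next
        case True
        have Y': "Y \<in> ?\<C>" using Y by simp
        have disjY: "fst Y \<inter> snd Y = {}" using elim_systemD(1)[OF es Y'] .
        \<comment> \<open>Outside \<open>S\<close> the circuit \<open>X'\<close> consists of
          \<open>e\<close> alone, so eliminating \<open>e\<close> against it clears \<open>e\<close>
          from \<open>Y\<close> and adds nothing else there; the result contradicts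
          \<open>d\<close>.\<close>
        obtain X' where X': "X' \<in> ?\<C>" "supp X' \<subseteq> insert e S"
          "e \<in> fst Y \<and> e \<in> snd X' \<or> e \<in> fst X' \<and> e \<in> snd Y"
        proof (cases "e \<in> fst Y \<longleftrightarrow> e \<in> snd X")
          case True
          then show ?thesis using that[of X] X \<open>e \<in> supp Y\<close> disjX disjY by (auto simp: supp_def)
        next
          case False
          then show ?thesis
            using that[of "prod.swap X"] X swapX \<open>e \<in> supp Y\<close> disjX disjY by (auto simp: supp_def)
        qed
        have small: "fst X' - S \<subseteq> {e}" "snd X' - S \<subseteq> {e}" using X'(2) by (auto simp: supp_def)
        obtain y where y: "y \<in> supp Y" "y \<notin> S" "y \<noteq> e" using Y(3) by blast
        have "\<exists>Z\<in>?\<C>. \<not> supp Z \<subseteq> S \<and> fst Z - S \<subseteq> (fst Y \<union> fst X') - {e} \<and>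
            snd Z - S \<subseteq> (snd Y \<union> snd X') - {e}"
          using X'(3)
        proof
          assume c: "e \<in> fst Y \<and> e \<in> snd X'"
          have "\<not> (fst X' - S = snd Y - S \<and> snd X' - S = fst Y - S)"
            using small y unfolding supp_def by blast
          with c show ?thesis
            using elim_outside[OF om' finS Y' X'(1), of e] eES(2) by (metis (lifting))
        next
          assume c: "e \<in> fst X' \<and> e \<in> snd Y"
          have "\<not> (fst Y - S = snd X' - S \<and> snd Y - S = fst X' - S)"
            using small y unfolding supp_def by blast
          with c show ?thesis
            using elim_outside[OF om' finS X'(1) Y', of e] eES(2) by (metis (lifting) Un_commute)
        qed
        then obtain Z where Z: "Z \<in> ?\<C>" "\<not> supp Z \<subseteq> S"
          and Z': "fst Z - S \<subseteq> (fst Y \<union> fst X') - {e}" "snd Z - S \<subseteq> (snd Y \<union> snd X') - {e}"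
          by (elim bexE conjE)
        have ZY: "fst Z - S \<subseteq> fst Y - {e}" "snd Z - S \<subseteq> snd Y - {e}"
          using Z' small by blast+
        have eZ: "e \<notin> supp Z" using ZY eES(2) unfolding supp_def by blast
        have "fst Z \<inter> (A - {e}) \<subseteq> S" using ZY(1) Y(4) by blast
        moreover have "snd Z \<subseteq> (A - {e}) \<union> S" using ZY(2) Y(5) by blast
        moreover have "supp Z \<subseteq> E - {e}" using Z(1) eZ by blast
        ultimately show False
          using covectorD[OF d, of Z] Z by blast
      qed
    qed
    ultimately show ?thesis using up r by auto
  next
    case False
    have r: "r (insert e S) = Suc (r S)"
      using representsD[OF rep, of S e] False S A eES by auto
    have z_iff: "?z \<longleftrightarrow> ?n \<and> ?p"
    proof (intro iffI conjI)
      assume z: ?z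
      show ?n
      proof (rule covectorI)
        fix X assume "X \<in> \<C>" "supp X \<subseteq> E" "\<not> supp X \<subseteq> S" "fst X \<inter> A \<subseteq> S" "snd X \<subseteq> A \<union> S"
        then show False using covectorD[OF z, of X] False by blast
      qed
      show ?p
      proof (rule covectorI)
        fix X assume "X \<in> \<C>" "supp X \<subseteq> E" "\<not> supp X \<subseteq> S" "fst X \<inter> (A - {e}) \<subseteq> S"
          "snd X \<subseteq> (A - {e}) \<union> S"
        then show False using covectorD[OF z, of X] False by blast
      qed
    next
      assume np: "?n \<and> ?p"
      show ?z
      proof (rule covectorI)
        fix X assume X: "X \<in> \<C>" "supp X \<subseteq> E" "\<not> supp X \<subseteq> insert e S"
          "fst X \<inter> A \<subseteq> insert e S" "snd X \<subseteq> A \<union> insert e S"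
        have "fst X \<inter> snd X = {}" using elim_systemD(1)[OF es, of X] X by blast
        then show False
          using covectorD[of \<C> E A S X] covectorD[of \<C> E "A - {e}" S X] X np e
          by (cases "e \<in> fst X") blast+
      qed
    qed
    \<comment> \<open>Circuits that exclude the two signed lifts have opposite signs at
      \<open>e\<close>. Elimination outside \<open>S\<close> turns them into a circuit that excludes
      the covector of the deletion.\<close>
    moreover have "?n \<or> ?p" if d: ?d
    proof (rule ccontr)
      assume "\<not> (?n \<or> ?p)"
      then have nn: "\<not> ?n" and np: "\<not> ?p" by auto
      obtain X where X: "X \<in> \<C>" "supp X \<subseteq> E" "\<not> supp X \<subseteq> S" "fst X \<inter> A \<subseteq> S" "snd X \<subseteq> A \<union> S"
        by (rule not_covectorE[OF nn])
      obtain Y where Y: "Y \<in> \<C>" "supp Y \<subseteq> E" "\<not> supp Y \<subseteq> S" "fst Y \<inter> (A - {e}) \<subseteq> S"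
        "snd Y \<subseteq> (A - {e}) \<union> S"
        by (rule not_covectorE[OF np])
      have "e \<in> supp X" using covectorD[OF d, of X] X no_e[of X] by (cases "e \<in> supp X") simp_all
      then have eX: "e \<in> snd X" using X(4) e eES by (auto simp: supp_def)
      have "e \<in> supp Y" using covectorD[OF d, of Y] Y no_e[of Y] by (cases "e \<in> supp Y") simp_all
      then have eY: "e \<in> fst Y" using Y(5) e eES by (auto simp: supp_def)
      have XY: "X \<in> ?\<C>" "Y \<in> ?\<C>" using X Y by auto
      have disj: "fst X \<inter> snd X = {}" "fst Y \<inter> snd Y = {}"
        using elim_systemD(1)[OF es] XY by auto
      \<comment> \<open>Away from \<open>S\<close> and \<open>e\<close> both circuits agree with the
        same sign vector, so one further element of \<open>X\<close> there prevents them from being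
        opposite outside \<open>S\<close>.\<close>
      obtain x where x: "x \<in> supp X" "x \<notin> S" "x \<noteq> e"
        using False X(1) eX by (auto simp: supp_def)
      have ne: "\<not> (fst X - S = snd Y - S \<and> snd X - S = fst Y - S)"
      proof
        assume eq: "fst X - S = snd Y - S \<and> snd X - S = fst Y - S"
        consider "x \<in> fst X" | "x \<in> snd X" using x(1) by (auto simp: supp_def)
        then show False
        proof cases
          case 1
          then have "x \<in> snd Y" "x \<notin> A" using eq x X(4) by auto
          then show False using Y(5) x by auto
        next
          case 2
          then have "x \<in> fst Y" "x \<in> A" using eq x X(5) by auto
          then show False using Y(4) x by auto
        qed
      qed
      obtain Z where Z: "Z \<in> ?\<C>" "\<not> supp Z \<subseteq> S" "fst Z - S \<subseteq> (fst Y \<union> fst X) - {e}"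
        "snd Z - S \<subseteq> (snd Y \<union> snd X) - {e}"
        by (rule elim_outside[OF om' finS XY(2,1) eY eX eES(2) ne])
      have "e \<notin> supp Z" using Z(3,4) eES(2) unfolding supp_def by blast
      moreover have "fst Z \<inter> (A - {e}) \<subseteq> S" using Z(3) X(4) Y(4) by blast
      moreover have "snd Z \<subseteq> (A - {e}) \<union> S" using Z(4) X(5) Y(5) by blast
      moreover have "supp Z \<subseteq> E - {e}" using Z(1) calculation(1) by blast
      ultimately show False using covectorD[OF d, of Z] Z(1,2) by blast
    qed
    ultimately show ?thesis using up r by auto
  qed
qed

text \<open>In the realizable case this is, up to sign, the Euler characteristic with compact
  supports of the region that is positive on \<open>E - A\<close> and nonpositive on
  \<open>A\<close>. The regions for \<open>A\<close> and \<open>A - {e}\<close> together form a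
  region of the deletion of \<open>e\<close>, so the sums add. Both regions other than that of
  \<open>A\<close> contribute zero, unless \<open>A = {e}\<close>, when they contribute equal units.
  The last hypothesis makes the all-positive vector a covector, which is the case
  \<open>A = {}\<close>.\<close>

lemma euler_relation:
  assumes om: "oriented_matroid E0 \<C>" and "finite E" "represents \<C> E r" "A \<subseteq> E"
    and "\<And>X. X \<in> \<C> \<Longrightarrow> supp X \<subseteq> E \<Longrightarrow> snd X \<noteq> {}"
  shows "(\<Sum>S\<in>Pow A. if covector \<C> E A S then (-1) ^ r S else 0) = (if A = {} then (-1) ^ r {} else (0 :: int))"
  using assms(2-)
proof (induction "card A" arbitrary: A E)
  case 0
  then have "A = {}" by (simp add: finite_subset)
  moreover have "covector \<C> E {} {}" using 0(5) by (auto simp: covector_def)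
  ultimately show ?case by simp
next
  case (Suc n A E)
  then obtain e where e: "e \<in> A" by fastforce
  define B where "B = A - {e}"
  have finB: "finite B" "e \<notin> B" and A: "A = insert e B"
    using Suc.prems(1,3) e by (auto simp: B_def finite_subset)
  have cardB: "n = card B" using Suc.hyps(2) A finB by simp
  define f where "f E A = (\<Sum>S\<in>Pow A. if covector \<C> E A S then (-1) ^ r S else (0 :: int))" for E A
  have "f E A + f E B = f (E - {e}) B"
    unfolding f_def A sum_Pow_insert[OF finB] sum.distrib[symmetric]
  proof (intro sum.cong refl)
    fix S assume "S \<in> Pow B"
    then show "((if covector \<C> E (insert e B) S then (-1) ^ r S else 0) +
        (if covector \<C> E (insert e B) (insert e S) then (-1) ^ r (insert e S) else 0)) +
        (if covector \<C> E B S then (-1) ^ r S else 0) =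
      (if covector \<C> (E - {e}) B S then (-1) ^ r S else (0 :: int))"
      using covector_lift[OF om Suc.prems(1,2), of e "insert e B" S] Suc.prems(3) finB(2) by (simp add: A)
  qed
  moreover have "f E B = (if B = {} then (-1) ^ r {} else 0)"
    unfolding f_def using Suc.prems by (intro Suc.hyps(1)[OF cardB]) (auto simp: A)
  moreover have "f (E - {e}) B = (if B = {} then (-1) ^ r {} else 0)"
    unfolding f_def
  proof (intro Suc.hyps(1)[OF cardB])
    show "represents \<C> (E - {e}) r" using Suc.prems(2) unfolding represents_def by blast
    show "snd X \<noteq> {}" if "X \<in> \<C>" "supp X \<subseteq> E - {e}" for X
      using that Suc.prems(4) by blast
  qed (use Suc.prems finB in \<open>auto simp: A\<close>)
  ultimately show ?case by (simp add: A f_def)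
qed

section \<open>Initial degenerations\<close>

definition argmin_on :: "('a \<Rightarrow> nat) \<Rightarrow> 'a set \<Rightarrow> 'a set" where
  "argmin_on w S = {e \<in> S. \<forall>x\<in>S. w e \<le> w x}"

text \<open>Bases of \<open>M_w\<close> have maximal weight, so the elements of a circuit that can
  be exchanged for one another without loss are those of least weight. These parts carry the
  dependences of \<open>M_w\<close>; see \<open>rk_initial_insert\<close>.\<close>

definition initial :: "('a \<Rightarrow> nat) \<Rightarrow> 'a set \<times> 'a set \<Rightarrow> 'a set \<times> 'a set" where
  "initial w X = (fst X \<inter> argmin_on w (supp X), snd X \<inter> argmin_on w (supp X))"

lemma supp_initial: "supp (initial w X) = argmin_on w (supp X)"
  by (auto simp: initial_def argmin_on_def supp_def)

lemma argmin_on_nonempty: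
  assumes "finite S" "S \<noteq> {}"
  shows "argmin_on w S \<noteq> {}"
proof -
  obtain e where "e \<in> S" "w e = Min (w ` S)"
    using assms by (metis (mono_tags) Min_in finite_imageI image_iff image_is_empty)
  then have "e \<in> argmin_on w S" using assms(1) by (simp add: argmin_on_def)
  then show ?thesis by blast
qed

lemma argmin_on_eq:
  assumes ge: "\<And>x. x \<in> S \<Longrightarrow> k \<le> w x" and y: "y \<in> S" "w y = k"
  shows "argmin_on w S = {x \<in> S. w x = k}"
proof (intro equalityI subsetI)
  fix x assume x: "x \<in> argmin_on w S"
  then have "x \<in> S" "w x \<le> w y" using y(1) by (auto simp: argmin_on_def)
  then show "x \<in> {x \<in> S. w x = k}" using ge[of x] y(2) by simp
next
  fix x assume "x \<in> {x \<in> S. w x = k}"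
  then show "x \<in> argmin_on w S" using ge by (simp add: argmin_on_def)
qed

text \<open>Circuits whose parts of least weight share \<open>e\<close> have the same minimum
  \<open>w e\<close>, so both parts arise by removing the set \<open>S\<close> of heavier elements.
  A circuit from \<open>elim_outside\<close> keeps an element outside \<open>S\<close>, hence has
  this minimum as well.\<close>

lemma elim_system_initial:
  assumes om: "oriented_matroid E \<C>"
  shows "elim_system (initial w ` \<C>)"
  unfolding elim_system_def
proof (intro conjI ballI allI impI)
  note es = oriented_matroid_imp_elim_system[OF om]
  have finE: "finite E" and subE: "\<And>X. X \<in> \<C> \<Longrightarrow> supp X \<subseteq> E"
    using om unfolding oriented_matroid_def by auto
  fix U assume "U \<in> initial w ` \<C>"
  then obtain X where X: "X \<in> \<C>" "U = initial w X" by blast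
  show "fst U \<inter> snd U = {}" using X elim_systemD(1)[OF es X(1)] by (auto simp: initial_def)
  have "finite (supp X)" using subE[OF X(1)] finE finite_subset by blast
  then show "supp U \<noteq> {}"
    using argmin_on_nonempty elim_systemD(2)[OF es X(1)] by (simp add: X(2) supp_initial)
  have "prod.swap U = initial w (prod.swap X)" by (simp add: X(2) initial_def prod_eq_iff)
  then show "prod.swap U \<in> initial w ` \<C>" using elim_systemD(3)[OF es X(1)] by blast
  fix V e assume "V \<in> initial w ` \<C>" and e: "U \<noteq> prod.swap V \<and> e \<in> fst U \<inter> snd V"
  then obtain Y where Y: "Y \<in> \<C>" "V = initial w Y" by blast
  define S where "S = {x \<in> E. w e < w x}"
  have eX: "e \<in> fst X" "e \<in> argmin_on w (supp X)" and eY: "e \<in> snd Y" "e \<in> argmin_on w (supp Y)"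
    using e X(2) Y(2) by (auto simp: initial_def)
  have ge: "w e \<le> w x" if "x \<in> supp X \<union> supp Y" for x
    using that eX(2) eY(2) by (auto simp: argmin_on_def)
  have argX: "argmin_on w (supp X) = supp X - S" and argY: "argmin_on w (supp Y) = supp Y - S"
    using eX(2) eY(2) subE[OF X(1)] subE[OF Y(1)] by (force simp: argmin_on_def S_def)+
  have U: "fst U = fst X - S" "snd U = snd X - S" and V: "fst V = fst Y - S" "snd V = snd Y - S"
    unfolding X(2) Y(2) initial_def argX argY by (auto simp: supp_def)
  have ne: "\<not> (fst Y - S = snd X - S \<and> snd Y - S = fst X - S)"
    using e U V by (auto simp: eq_swap_iff)
  have finS: "finite S" and eS: "e \<notin> S" using finE by (auto simp: S_def)
  obtain Z where Z: "Z \<in> \<C>" "\<not> supp Z \<subseteq> S" "fst Z - S \<subseteq> (fst X \<union> fst Y) - {e}"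
    "snd Z - S \<subseteq> (snd X \<union> snd Y) - {e}"
    by (rule elim_outside[OF om finS X(1) Y(1) eX(1) eY(1) eS ne])
  have "argmin_on w (supp Z) = supp Z - S"
  proof -
    have ZS: "w x = w e" if "x \<in> supp Z - S" for x
    proof -
      have "x \<in> supp X \<union> supp Y" using that Z(3,4) unfolding supp_def by blast
      moreover from this have "x \<in> E" using subE[OF X(1)] subE[OF Y(1)] by blast
      ultimately show ?thesis using ge[of x] that by (auto simp: S_def)
    qed
    have lt: "w e < w x" if "x \<in> S" for x using that by (simp add: S_def)
    obtain z where z: "z \<in> supp Z - S" using Z(2) by blast
    show ?thesis
    proof (intro equalityI subsetI)
      fix x assume "x \<in> argmin_on w (supp Z)"
      then have "x \<in> supp Z" "w x \<le> w z" using z by (auto simp: argmin_on_def)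
      then show "x \<in> supp Z - S" using ZS[OF z] lt[of x] by auto
    next
      fix x assume x: "x \<in> supp Z - S"
      have "w x \<le> w y" if "y \<in> supp Z" for y
        using ZS[OF x] ZS[of y] lt[of y] that by (cases "y \<in> S") auto
      then show "x \<in> argmin_on w (supp Z)" using x by (simp add: argmin_on_def)
    qed
  qed
  then have "fst (initial w Z) = fst Z - S" "snd (initial w Z) = snd Z - S"
    by (auto simp: initial_def supp_def)
  then show "\<exists>Z\<in>initial w ` \<C>. fst Z \<subseteq> (fst U \<union> fst V) - {e} \<and> snd Z \<subseteq> (snd U \<union> snd V) - {e}"
    using Z U V by (intro bexI[of _ "initial w Z"]) auto
qed

section \<open>Cancellation over the top level of a weight\<close>

definition lower :: "'a set \<Rightarrow> ('a \<Rightarrow> nat) \<Rightarrow> 'a \<Rightarrow> nat" where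
  "lower D a = (\<lambda>e. if e \<in> D then a e - 1 else a e)"

lemma sum_Pow_Un:
  assumes "finite A" "finite B" "A \<inter> B = {}"
  shows "(\<Sum>S\<in>Pow (A \<union> B). f S) = (\<Sum>S\<in>Pow A. \<Sum>T\<in>Pow B. f (S \<union> T))"
proof -
  have "(\<Sum>S\<in>Pow A. \<Sum>T\<in>Pow B. f (S \<union> T)) = (\<Sum>(S, T)\<in>Pow A \<times> Pow B. f (S \<union> T))"
    by (rule sum.cartesian_product)
  also have "\<dots> = (\<Sum>S\<in>Pow (A \<union> B). f S)"
  proof (rule sum.reindex_bij_witness[of _ "\<lambda>S. (S \<inter> A, S \<inter> B)" "\<lambda>(S, T). S \<union> T"])
    fix x assume "x \<in> Pow A \<times> Pow B"
    then obtain S T where x: "x = (S, T)" "S \<subseteq> A" "T \<subseteq> B" by blast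
    then have "(S \<union> T) \<inter> A = S" "(S \<union> T) \<inter> B = T" using assms(3) by blast+
    then show "((case x of (S, T) \<Rightarrow> S \<union> T) \<inter> A, (case x of (S, T) \<Rightarrow> S \<union> T) \<inter> B) = x"
      by (simp add: x(1))
    show "(case x of (S, T) \<Rightarrow> S \<union> T) \<in> Pow (A \<union> B)" using x by auto
    show "f (case x of (S, T) \<Rightarrow> S \<union> T) = (case x of (S, T) \<Rightarrow> f (S \<union> T))" by (simp add: x(1))
  next
    fix S assume S: "S \<in> Pow (A \<union> B)"
    then show "(case (S \<inter> A, S \<inter> B) of (S, T) \<Rightarrow> S \<union> T) = S" by auto
    show "(S \<inter> A, S \<inter> B) \<in> Pow A \<times> Pow B" by simp
  qed
  finally show ?thesis by simp
qed

lemma sum_Pow_Diff: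
  assumes "finite A"
  shows "(\<Sum>S\<in>Pow A. f (A - S)) = (\<Sum>S\<in>Pow A. f S)"
  by (rule sum.reindex_bij_witness[of _ "\<lambda>S. A - S" "\<lambda>S. A - S"]) (auto simp: double_diff)

text \<open>Only the top level of \<open>a\<close> is varied: for a fixed choice \<open>N\<close> below it, the conditions on
  the remaining part of \<open>D\<close> describe the faces of a region in a restriction of \<open>\<C>\<close>.\<close>

lemma topes_initial_level:
  assumes om: "oriented_matroid E \<C>" and pos: "{} \<in> topes E \<C>"
    and k: "0 < k" "\<And>e. e \<in> E \<Longrightarrow> a e \<le> k"
    and A: "A = {e \<in> E. a e = k}" and N: "N \<subseteq> {e \<in> E. 0 < a e \<and> a e < k}"
    and S: "S \<subseteq> A"
  defines "F \<equiv> A \<union> {e \<in> E. Suc (a e) = k \<and> e \<notin> N}"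
  shows "N \<union> (A - S) \<in> topes E (initial (lower (N \<union> (A - S)) a) ` \<C>) \<longleftrightarrow>
    (\<forall>X\<in>\<C>. \<not> supp X \<subseteq> F \<longrightarrow> \<not> conforms N (initial (lower (N \<union> A) a) X)) \<and> covector \<C> F A S"
proof -
  define w where "w = lower (N \<union> (A - S)) a"
  define w0 where "w0 = lower (N \<union> A) a"
  have subE: "\<And>X. X \<in> \<C> \<Longrightarrow> supp X \<subseteq> E"
    using om unfolding oriented_matroid_def by auto
  have NA: "N \<inter> A = {}" "N \<inter> F = {}" using N A by (auto simp: F_def)
  have AF: "A \<subseteq> F" "S \<subseteq> F" using S by (auto simp: F_def)
  \<comment> \<open>\<open>F\<close> is the top level \<open>k - 1\<close> of \<open>w0\<close>: the
    elements of \<open>A\<close> once lowered, and those of level \<open>k - 1\<close> that are left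
    alone. Only on this set does \<open>w\<close> depend on \<open>S\<close>.\<close>
  have wF: "w e = (if e \<in> S then k else k - 1)" "w0 e = k - 1" if "e \<in> F" for e
    using that NA S A N by (auto simp: w_def w0_def lower_def F_def)
  have wE: "w e < k - 1" "w0 e = w e" if "e \<in> E" "e \<notin> F" for e
    using that NA S A N k(2)[of e] by (auto simp: w_def w0_def lower_def F_def)
  \<comment> \<open>A circuit that leaves \<open>F\<close> has its minimum below
    \<open>k - 1\<close>. There \<open>w\<close> agrees with \<open>w0\<close>, and only
    \<open>N\<close> is left of the set \<open>N \<union> (A - S)\<close>.\<close>
  have out: "conforms (N \<union> (A - S)) (initial w X) \<longleftrightarrow> conforms N (initial w0 X)"
    if X: "X \<in> \<C>" "\<not> supp X \<subseteq> F" for X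
  proof -
    obtain x where x: "x \<in> supp X" "x \<notin> F" "x \<in> E" using X subE by blast
    have "argmin_on w (supp X) = argmin_on w0 (supp X)" "argmin_on w (supp X) \<inter> F = {}"
    proof -
      show disj: "argmin_on w (supp X) \<inter> F = {}"
      proof -
        have "\<not> w y \<le> w x" if "y \<in> F" for y using that x wE(1)[of x] wF(1)[of y] k(1) by auto
        then show ?thesis using x(1) by (auto simp: argmin_on_def)
      qed
      have disj0: "argmin_on w0 (supp X) \<inter> F = {}"
      proof -
        have "\<not> w0 y \<le> w0 x" if "y \<in> F" for y using that x wE[of x] wF(2)[of y] by auto
        then show ?thesis using x(1) by (auto simp: argmin_on_def)
      qed
      have le: "w0 y \<le> w y" if "y \<in> supp X" for y
        using wF[of y] wE(2)[of y] subE[OF X(1)] that by (cases "y \<in> F") auto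
      show "argmin_on w (supp X) = argmin_on w0 (supp X)"
      proof (intro equalityI subsetI)
        fix e assume e: "e \<in> argmin_on w (supp X)"
        then have eX: "e \<in> supp X" "e \<notin> F" "e \<in> E" using disj subE[OF X(1)] by (auto simp: argmin_on_def)
        have "w0 e \<le> w0 y" if y: "y \<in> supp X" for y
        proof (cases "y \<in> F")
          case True
          then show ?thesis using wE[OF eX(3,2)] wF(2)[of y] by simp
        next
          case False
          then show ?thesis using wE(2) eX e y subE[OF X(1)] by (auto simp: argmin_on_def)
        qed
        then show "e \<in> argmin_on w0 (supp X)" using eX by (simp add: argmin_on_def)
      next
        fix e assume e: "e \<in> argmin_on w0 (supp X)"
        then have eX: "e \<in> supp X" "e \<notin> F" "e \<in> E" using disj0 subE[OF X(1)] by (auto simp: argmin_on_def)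
        have "w e \<le> w y" if y: "y \<in> supp X" for y
        proof -
          have "w e = w0 e" using wE(2) eX by simp
          also have "\<dots> \<le> w0 y" using e y by (simp add: argmin_on_def)
          also have "\<dots> \<le> w y" by (rule le[OF y])
          finally show ?thesis .
        qed
        then show "e \<in> argmin_on w (supp X)" using eX by (simp add: argmin_on_def)
      qed
    qed
    then have "initial w X = initial w0 X" "supp (initial w X) \<inter> A = {}"
      using AF(1) unfolding supp_initial by (auto simp: initial_def)
    then show ?thesis by (auto simp: conforms_def supp_def)
  qed
  \<comment> \<open>For a circuit in \<open>F\<close> the part of least weight is what lies outside
    \<open>S\<close>, if that is nonempty. A circuit within \<open>S\<close> is its own part of
    least weight; conformity would make it all-positive, which the tope \<open>{}\<close>
    excludes.\<close>
  have inside: "conforms (N \<union> (A - S)) (initial w X) \<longleftrightarrow>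
      \<not> supp X \<subseteq> S \<and> fst X \<inter> A \<subseteq> S \<and> snd X \<subseteq> A \<union> S" if X: "X \<in> \<C>" "supp X \<subseteq> F" for X
  proof (cases "supp X \<subseteq> S")
    case True
    have "w x = k" if "x \<in> supp X" for x
    proof -
      have "x \<in> S" "x \<in> F" using True X(2) that by blast+
      then show ?thesis using wF(1)[of x] by simp
    qed
    then have "argmin_on w (supp X) = supp X" by (auto simp: argmin_on_def)
    then have "initial w X = X" by (auto simp: initial_def supp_def prod_eq_iff)
    moreover have "supp X \<inter> (N \<union> (A - S)) = {}" using True NA X(2) by blast
    moreover have "\<not> conforms {} X" using pos X(1) by (simp add: topes_def)
    ultimately show ?thesis using True by (auto simp: conforms_def supp_def)
  next
    case False
    then obtain y where y: "y \<in> supp X" "y \<notin> S" by blast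
    have wX: "w x = (if x \<in> S then k else k - 1)" if "x \<in> supp X" for x
      using wF(1) X(2) that by blast
    have "argmin_on w (supp X) = {x \<in> supp X. w x = k - 1}"
      by (rule argmin_on_eq[of _ _ _ y]) (use wX y in auto)
    also have "\<dots> = supp X - S" using wX k(1) by auto
    finally have "initial w X = (fst X - S, snd X - S)" by (auto simp: initial_def supp_def)
    then show ?thesis using False X(2) NA S by (auto simp: conforms_def supp_def)
  qed
  have sub: "N \<union> (A - S) \<subseteq> E" using N A by auto
  have "N \<union> (A - S) \<in> topes E (initial w ` \<C>) \<longleftrightarrow> (\<forall>X\<in>\<C>. \<not> conforms (N \<union> (A - S)) (initial w X))"
    using sub by (simp add: topes_def)
  also have "\<dots> \<longleftrightarrow> (\<forall>X\<in>\<C>. \<not> supp X \<subseteq> F \<longrightarrow> \<not> conforms (N \<union> (A - S)) (initial w X)) \<and>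
      (\<forall>X\<in>\<C>. supp X \<subseteq> F \<longrightarrow> \<not> conforms (N \<union> (A - S)) (initial w X))"
    by blast
  also have "\<dots> \<longleftrightarrow> (\<forall>X\<in>\<C>. \<not> supp X \<subseteq> F \<longrightarrow> \<not> conforms N (initial w0 X)) \<and> covector \<C> F A S"
    unfolding covector_def using out inside by (auto simp del: split_paired_All)
  finally show ?thesis unfolding w_def w0_def .
qed

text \<open>Let \<open>A\<close> be the set where \<open>a\<close> is largest and write
  \<open>D\<close> as \<open>N \<union> (A - S)\<close> with \<open>N\<close> below
  \<open>A\<close>. For fixed \<open>N\<close> the exponent is a constant plus \<open>r S\<close>,
  and the tope condition is the conjunction of a condition on \<open>N\<close> and one on the face
  \<open>S\<close>. The inner sum is thus a multiple of the Euler sum for the nonempty set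
  \<open>A\<close>. \<open>W\<close> abstracts the maximal weight, of which just the growth along
  the top level enters.\<close>

lemma sum_lower_topes_eq_0:
  assumes om: "oriented_matroid E \<C>" and pos: "{} \<in> topes E \<C>" and rep: "represents \<C> E r"
    and W: "\<And>w k S. S \<subseteq> E \<Longrightarrow> (\<And>e. e \<in> E \<Longrightarrow> w e \<le> k) \<Longrightarrow> (\<And>e. e \<in> S \<Longrightarrow> w e = k) \<Longrightarrow>
      W (\<lambda>e. if e \<in> S then Suc (w e) else w e) = W w + r S"
    and a: "e0 \<in> E" "0 < a e0"
  shows "(\<Sum>D\<in>Pow {e \<in> E. 0 < a e}.
    if D \<in> topes E (initial (lower D a) ` \<C>) then (-1) ^ W (lower D a) else (0 :: int)) = 0"
proof -
  have fin: "finite E" using om unfolding oriented_matroid_def by auto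
  define k where "k = Max (a ` E)"
  have k: "0 < k" "\<And>e. e \<in> E \<Longrightarrow> a e \<le> k"
    using fin a by (auto simp: k_def intro: less_le_trans)
  have "k \<in> a ` E" unfolding k_def using fin a by (intro Max_in) auto
  then obtain e1 where e1: "e1 \<in> E" "a e1 = k" by auto
  define A where "A = {e \<in> E. a e = k}"
  define L where "L = {e \<in> E. 0 < a e \<and> a e < k}"
  have AL: "{e \<in> E. 0 < a e} = L \<union> A" "L \<inter> A = {}" "finite A" "finite L" "A \<noteq> {}" "A \<subseteq> E"
    using k e1 fin by (auto simp: A_def L_def order.order_iff_strict)
  define f where "f D = (if D \<in> topes E (initial (lower D a) ` \<C>) then (-1) ^ W (lower D a) else (0 :: int))" for D
  have "(\<Sum>S\<in>Pow A. f (N \<union> (A - S))) = 0" if N: "N \<subseteq> L" for N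
  proof -
    define F where "F = A \<union> {e \<in> E. Suc (a e) = k \<and> e \<notin> N}"
    define c where "c \<longleftrightarrow> (\<forall>X\<in>\<C>. \<not> supp X \<subseteq> F \<longrightarrow> \<not> conforms N (initial (lower (N \<union> A) a) X))"
    define w0 where "w0 = lower (N \<union> A) a"
    have FE: "F \<subseteq> E" "finite F" using AL fin by (auto simp: F_def)
    have "f (N \<union> (A - S)) = (if c then (-1) ^ W w0 else 0) * (if covector \<C> F A S then (-1) ^ r S else 0)"
      if S: "S \<subseteq> A" for S
    proof -
      have "lower (N \<union> (A - S)) a = (\<lambda>e. if e \<in> S then Suc (w0 e) else w0 e)"
        using S N k(1) by (auto simp: lower_def w0_def A_def L_def fun_eq_iff)
      moreover have "W (\<lambda>e. if e \<in> S then Suc (w0 e) else w0 e) = W w0 + r S"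
      proof (rule W[where k = "k - 1"])
        show "S \<subseteq> E" using S AL by auto
        show "w0 e \<le> k - 1" if "e \<in> E" for e
          using k(2)[OF that] that by (auto simp: w0_def lower_def A_def)
        show "w0 e = k - 1" if "e \<in> S" for e
          using that S by (auto simp: w0_def lower_def A_def)
      qed
      moreover have "N \<union> (A - S) \<in> topes E (initial (lower (N \<union> (A - S)) a) ` \<C>) \<longleftrightarrow> c \<and> covector \<C> F A S"
        unfolding c_def F_def
        by (rule topes_initial_level[OF om pos k A_def N[unfolded L_def] S])
      ultimately show ?thesis by (simp add: f_def power_add)
    qed
    then have "(\<Sum>S\<in>Pow A. f (N \<union> (A - S))) = (if c then (-1) ^ W w0 else 0) *
        (\<Sum>S\<in>Pow A. if covector \<C> F A S then (-1) ^ r S else 0)"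
      by (simp add: sum_distrib_left)
    also have "(\<Sum>S\<in>Pow A. if covector \<C> F A S then (-1) ^ r S else 0) = (0 :: int)"
    proof (subst euler_relation[OF om FE(2)])
      show "represents \<C> F r" using rep FE(1) unfolding represents_def by blast
      show "A \<subseteq> F" by (simp add: F_def)
      show "snd X \<noteq> {}" if "X \<in> \<C>" "supp X \<subseteq> F" for X
        using pos that by (auto simp: topes_def conforms_def)
    qed (use AL in auto)
    finally show ?thesis by simp
  qed
  then have "(\<Sum>S\<in>Pow A. f (N \<union> S)) = 0" if "N \<in> Pow L" for N
    using sum_Pow_Diff[OF AL(3), of "\<lambda>S. f (N \<union> S)"] that by simp
  then have "(\<Sum>N\<in>Pow L. \<Sum>S\<in>Pow A. f (N \<union> S)) = 0" by simp
  then show ?thesis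
    unfolding AL(1) f_def[symmetric] using sum_Pow_Un[OF AL(4,3,2), of f] by simp
qed

section \<open>Rank and weight of initial matroids\<close>

lemma matroidD:
  assumes "is_matroid M"
  shows "finite (ground M)" "bases M \<noteq> {}" "B \<in> bases M \<Longrightarrow> B \<subseteq> ground M"
    "B \<in> bases M \<Longrightarrow> finite B" "finite (bases M)"
proof -
  show fin: "finite (ground M)" and "bases M \<noteq> {}" and sub: "B \<in> bases M \<Longrightarrow> B \<subseteq> ground M" for B
    using assms by (auto simp: is_matroid_def)
  show "B \<in> bases M \<Longrightarrow> finite B" using fin sub finite_subset by blast
  have "bases M \<subseteq> Pow (ground M)" using sub by blast
  then show "finite (bases M)" using fin by (simp add: finite_subset)
qed

lemma matroid_exchange:
  assumes "is_matroid M" "A \<in> bases M" "B \<in> bases M" "a \<in> A" "a \<notin> B"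
  obtains b where "b \<in> B" "b \<notin> A" "insert b (A - {a}) \<in> bases M"
proof -
  have "\<forall>A\<in>bases M. \<forall>B\<in>bases M. \<forall>a\<in>A - B. \<exists>b\<in>B - A. insert b (A - {a}) \<in> bases M"
    using assms(1) unfolding is_matroid_def by (elim conjE)
  then have "\<exists>b\<in>B - A. insert b (A - {a}) \<in> bases M" using assms(2-5) by blast
  then show ?thesis using that by blast
qed

lemma matroid_basis_subset_eq:
  assumes "is_matroid M" "A \<in> bases M" "B \<in> bases M" "A \<subseteq> B"
  shows "A = B"
proof (rule ccontr)
  assume "A \<noteq> B"
  then obtain b where "b \<in> B" "b \<notin> A" using assms(4) by blast
  then show False using matroid_exchange[OF assms(1,3,2)] assms(4) by blast
qed

lemma matroid_card_bases:
  assumes "is_matroid M" "A \<in> bases M" "B \<in> bases M"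
  shows "card A = card B"
  using assms(2)
proof (induction "card (A - B)" arbitrary: A rule: less_induct)
  case less
  show ?case
  proof (cases "A \<subseteq> B")
    case True
    then show ?thesis using matroid_basis_subset_eq[OF assms(1) less.prems assms(3)] by simp
  next
    case False
    then obtain a where a: "a \<in> A" "a \<notin> B" by blast
    obtain b where b: "b \<in> B" "b \<notin> A" "insert b (A - {a}) \<in> bases M"
      using matroid_exchange[OF assms(1) less.prems assms(3) a] .
    have finA: "finite A" using matroidD(4)[OF assms(1) less.prems] .
    have "insert b (A - {a}) - B = (A - B) - {a}" using b by auto
    then have "card (insert b (A - {a}) - B) < card (A - B)"
      using a finA by (metis DiffI card_Diff1_less finite_Diff)
    then have "card (insert b (A - {a})) = card B" using less.hyps b(3) by blast
    moreover have "card (insert b (A - {a})) = card A"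
      using a b finA by (simp add: card_Diff_singleton card_gt_0_iff) (metis Suc_pred card_gt_0_iff empty_iff)
    ultimately show ?thesis by simp
  qed
qed

text \<open>Among the bases containing \<open>I\<close>, take one with the largest intersection with
  \<open>B\<close>. An element of it outside \<open>I \<union> B\<close> could be exchanged for a
  new element of \<open>B\<close>.\<close>

lemma matroid_augment:
  assumes M: "is_matroid M" and I: "indep M I" and B: "B \<in> bases M"
  obtains D where "D \<in> bases M" "I \<subseteq> D" "D \<subseteq> I \<union> B"
proof -
  define P where "P D \<longleftrightarrow> D \<in> bases M \<and> I \<subseteq> D" for D
  obtain D0 where D0: "P D0" using I by (auto simp: P_def indep_def)
  have "\<forall>D. P D \<longrightarrow> card (D \<inter> B) < Suc (card B)"
    using matroidD(4)[OF M B] by (auto simp: less_Suc_eq_le intro: card_mono)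
  then obtain D where D: "P D" and max: "\<And>D'. P D' \<Longrightarrow> card (D' \<inter> B) \<le> card (D \<inter> B)"
    using ex_has_greatest_nat[of P D0 "\<lambda>D. card (D \<inter> B)"] D0 by blast
  have "D \<subseteq> I \<union> B"
  proof (rule ccontr)
    assume "\<not> ?thesis"
    then obtain d where d: "d \<in> D" "d \<notin> I" "d \<notin> B" by blast
    have DM: "D \<in> bases M" "I \<subseteq> D" using D by (auto simp: P_def)
    obtain b where b: "b \<in> B" "b \<notin> D" "insert b (D - {d}) \<in> bases M"
      using matroid_exchange[OF M DM(1) B d(1,3)] .
    then have "P (insert b (D - {d}))" using DM(2) d by (auto simp: P_def)
    moreover have "insert b (D - {d}) \<inter> B = insert b (D \<inter> B)" using b d by auto
    moreover have "card (insert b (D \<inter> B)) = Suc (card (D \<inter> B))"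
      using b matroidD(4)[OF M B] by simp
    ultimately show False using max[of "insert b (D - {d})"] by simp
  qed
  with D that show ?thesis by (auto simp: P_def)
qed

lemma indep_subset: "indep M J \<Longrightarrow> I \<subseteq> J \<Longrightarrow> indep M I"
  unfolding indep_def by blast

lemma dependent_contains_circuit:
  assumes "finite D" "D \<subseteq> ground M" "\<not> indep M D"
  obtains C where "circuit M C" "C \<subseteq> D"
  using assms
proof (induction D arbitrary: thesis rule: finite_psubset_induct)
  case (psubset D)
  show ?case
  proof (cases "\<forall>D'. D' \<subset> D \<longrightarrow> indep M D'")
    case True
    then have "circuit M D" using psubset.prems(2,3) by (simp add: circuit_def)
    then show ?thesis using psubset.prems(1) by blast
  next
    case False
    then obtain D' where D': "D' \<subset> D" "\<not> indep M D'" by blast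
    moreover have "D' \<subseteq> ground M" using D' psubset.prems(2) by blast
    ultimately obtain C where "circuit M C" "C \<subseteq> D'" using psubset.IH by metis
    then show ?thesis using psubset.prems(1)[of C] D' by blast
  qed
qed

lemma fundamental_circuit:
  assumes M: "is_matroid M" and B: "B \<in> bases M" and e: "e \<in> ground M" "e \<notin> B"
  obtains C where "circuit M C" "e \<in> C" "C \<subseteq> insert e B"
    "\<forall>x\<in>C. x \<noteq> e \<longrightarrow> insert e (B - {x}) \<in> bases M"
proof -
  have "\<not> indep M (insert e B)"
  proof
    assume "indep M (insert e B)"
    then obtain D where "D \<in> bases M" "insert e B \<subseteq> D" by (auto simp: indep_def)
    then show False using matroid_basis_subset_eq[OF M B, of D] e(2) by blast
  qed
  moreover have "finite (insert e B)" "insert e B \<subseteq> ground M" using matroidD(3,4)[OF M B] e by auto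
  ultimately obtain C where C: "circuit M C" "C \<subseteq> insert e B"
    using dependent_contains_circuit by metis
  have eC: "e \<in> C"
  proof (rule ccontr)
    assume "e \<notin> C"
    then have "indep M C" using C(2) B by (auto simp: indep_def)
    then show False using C(1) by (simp add: circuit_def)
  qed
  have "insert e (B - {x}) \<in> bases M" if x: "x \<in> C" "x \<noteq> e" for x
  proof -
    have "indep M (C - {x})" using C(1) x by (auto simp: circuit_def)
    then obtain D where D: "D \<in> bases M" "C - {x} \<subseteq> D" "D \<subseteq> (C - {x}) \<union> B"
      using matroid_augment[OF M _ B] by blast
    have xD: "x \<notin> D"
    proof
      assume "x \<in> D"
      then have "indep M C" using D(1,2) by (auto simp: indep_def)
      then show False using C(1) by (simp add: circuit_def)
    qed
    obtain b where "b \<in> D" "b \<notin> B" "insert b (B - {x}) \<in> bases M"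
      using matroid_exchange[OF M B D(1) _ xD] x C(2) by blast
    then show ?thesis using D(3) C(2) by blast
  qed
  with C eC that show ?thesis by blast
qed

lemma circuit_basis_exchange:
  assumes M: "is_matroid M" and B: "B \<in> bases M" and C: "circuit M C" and u: "u \<in> C" "u \<in> B"
  obtains x where "x \<in> C" "x \<notin> B" "insert x (B - {u}) \<in> bases M"
proof -
  have "indep M (C - {u})" using C u by (auto simp: circuit_def)
  then obtain D where D: "D \<in> bases M" "C - {u} \<subseteq> D" "D \<subseteq> (C - {u}) \<union> B"
    using matroid_augment[OF M _ B] by blast
  have "u \<notin> D"
  proof
    assume "u \<in> D"
    then have "indep M C" using D(1,2) by (auto simp: indep_def)
    then show False using C by (simp add: circuit_def)
  qed
  then obtain b where "b \<in> D" "b \<notin> B" "insert b (B - {u}) \<in> bases M"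
    using matroid_exchange[OF M B D(1) u(2)] by blast
  with D(3) that show ?thesis by blast
qed

lemma sum_exchange:
  fixes w :: "'a \<Rightarrow> nat"
  assumes "finite B" "u \<in> B" "x \<notin> B"
  shows "sum w (insert x (B - {u})) + w u = sum w B + w x"
  using assms by (simp add: sum.remove[of B u])

section \<open>Rank and maximal weight\<close>

lemma rk_ge:
  assumes "finite (ground M)" "\<And>B. B \<in> bases M \<Longrightarrow> B \<subseteq> ground M" "I \<subseteq> S" "indep M I"
  shows "card I \<le> rk M S"
proof -
  have "{I. I \<subseteq> S \<and> indep M I} \<subseteq> Pow (ground M)" using assms(2) by (auto simp: indep_def)
  then have "finite {I. I \<subseteq> S \<and> indep M I}" using assms(1) finite_subset by blast
  then show ?thesis using assms(3,4) unfolding rk_def by (intro Max_ge) auto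
qed

lemma rk_obtain:
  assumes "finite (ground M)" "\<And>B. B \<in> bases M \<Longrightarrow> B \<subseteq> ground M" "bases M \<noteq> {}"
  obtains I where "I \<subseteq> S" "indep M I" "card I = rk M S"
proof -
  have "{I. I \<subseteq> S \<and> indep M I} \<subseteq> Pow (ground M)" using assms(2) by (auto simp: indep_def)
  then have "finite {I. I \<subseteq> S \<and> indep M I}" using assms(1) finite_subset by blast
  moreover have "{} \<in> {I. I \<subseteq> S \<and> indep M I}" using assms(3) by (auto simp: indep_def)
  ultimately have "rk M S \<in> card ` {I. I \<subseteq> S \<and> indep M I}"
    unfolding rk_def by (intro Max_in) auto
  with that show ?thesis by auto
qed

lemma sum_le_wt:
  assumes "is_matroid M" "B \<in> bases M"
  shows "sum w B \<le> wt M w"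
  using matroidD(5)[OF assms(1)] assms(2) by (simp add: wt_def)

lemma wt_obtain:
  assumes "is_matroid M"
  obtains B where "B \<in> bases M" "sum w B = wt M w"
proof -
  have "wt M w \<in> (\<lambda>B. sum w B) ` bases M"
    unfolding wt_def using matroidD(2,5)[OF assms] by (intro Max_in) auto
  with that show ?thesis by auto
qed

lemma initial_matroidD:
  assumes "is_matroid M"
  shows "finite (ground (initial_matroid M w))"
    "B \<in> bases (initial_matroid M w) \<Longrightarrow> B \<subseteq> ground (initial_matroid M w)"
    "bases (initial_matroid M w) \<noteq> {}"
    "B \<in> bases (initial_matroid M w) \<longleftrightarrow> B \<in> bases M \<and> sum w B = wt M w"
proof -
  obtain B0 where "B0 \<in> bases M" "sum w B0 = wt M w" using wt_obtain[OF assms] .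
  then show "bases (initial_matroid M w) \<noteq> {}" by (auto simp: initial_matroid_def)
qed (use matroidD(1,3)[OF assms] in \<open>auto simp: initial_matroid_def\<close>)

text \<open>Given such a circuit, suppose the rank rose. An optimal basis containing
  \<open>e\<close> can exchange \<open>e\<close> for some \<open>x\<close> of the circuit;
  optimality puts \<open>x\<close> into \<open>argmin_on w C\<close>, hence into \<open>S\<close>,
  and an independent set of the larger size would fit into \<open>S\<close>. If there is no such
  circuit and \<open>e\<close> is not in the optimal basis \<open>B\<close>, its fundamental circuit
  over \<open>B\<close> has \<open>e\<close> among its minima and another minimum outside
  \<open>S\<close>, which \<open>e\<close> replaces at no cost.\<close>

lemma rk_initial_insert:
  assumes M: "is_matroid M" and e: "e \<in> ground M" "e \<notin> S"
  shows "rk (initial_matroid M w) (insert e S) = rk (initial_matroid M w) S +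
    (if \<exists>C. circuit M C \<and> e \<in> argmin_on w C \<and> argmin_on w C \<subseteq> insert e S then 0 else 1)"
proof -
  let ?M = "initial_matroid M w"
  note Mw = initial_matroidD[OF M, where w = w]
  have ge: "card I \<le> rk ?M T" if "I \<subseteq> T" "indep ?M I" for I T
    using rk_ge[OF Mw(1,2) that] .
  obtain I where I: "I \<subseteq> S" "indep ?M I" "card I = rk ?M S"
    using rk_obtain[OF Mw(1,2,3)] .
  obtain J where J: "J \<subseteq> insert e S" "indep ?M J" "card J = rk ?M (insert e S)"
    using rk_obtain[OF Mw(1,2,3)] .
  have finJ: "finite J" using J(2) Mw(2) Mw(1) finite_subset by (metis indep_def)
  have finI: "finite I" using I(2) Mw(2) Mw(1) finite_subset by (metis indep_def)
  have lower: "rk ?M S \<le> rk ?M (insert e S)" using ge[of I "insert e S"] I by auto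
  have "card J \<le> Suc (card (J - {e}))" using finJ by (metis Diff_empty Diff_insert0 card_Suc_Diff1 le_SucI order_refl)
  also have "card (J - {e}) \<le> rk ?M S"
    using J(1) indep_subset[OF J(2)] by (intro ge) auto
  finally have upper: "rk ?M (insert e S) \<le> Suc (rk ?M S)" using J(3) by simp
  show ?thesis
  proof (cases "\<exists>C. circuit M C \<and> e \<in> argmin_on w C \<and> argmin_on w C \<subseteq> insert e S")
    case True
    then obtain C where C: "circuit M C" "e \<in> argmin_on w C" "argmin_on w C \<subseteq> insert e S" by blast
    have eC: "e \<in> C" using C(2) by (simp add: argmin_on_def)
    have "rk ?M (insert e S) \<noteq> Suc (rk ?M S)"
    proof
      assume eq: "rk ?M (insert e S) = Suc (rk ?M S)"
      have eJ: "e \<in> J" using ge[of J S] J eq by (cases "e \<in> J") auto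
      obtain B where B: "B \<in> bases M" "sum w B = wt M w" "J \<subseteq> B"
        using J(2) Mw(4) by (auto simp: indep_def)
      have finB: "finite B" using matroidD(4)[OF M B(1)] .
      obtain x where x: "x \<in> C" "x \<notin> B" "insert x (B - {e}) \<in> bases M"
        using circuit_basis_exchange[OF M B(1) C(1) eC] eJ B(3) by blast
      have "sum w (insert x (B - {e})) + w e = sum w B + w x"
        using sum_exchange[OF finB _ x(2)] eJ B(3) by blast
      moreover have "sum w (insert x (B - {e})) \<le> wt M w" by (rule sum_le_wt[OF M x(3)])
      moreover have "w e \<le> w x" using C(2) x(1) by (simp add: argmin_on_def)
      ultimately have wx: "w x = w e" "sum w (insert x (B - {e})) = wt M w" using B(2) by auto
      have "x \<in> argmin_on w C" using wx(1) x(1) C(2) by (simp add: argmin_on_def)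
      moreover have "x \<noteq> e" using x(2) eJ B(3) by blast
      ultimately have "insert x (J - {e}) \<subseteq> S" using C(3) J(1) by auto
      moreover have "indep ?M (insert x (J - {e}))"
        unfolding indep_def using x(3) wx(2) Mw(4) B(3) by (intro bexI[of _ "insert x (B - {e})"]) auto
      ultimately have "card (insert x (J - {e})) \<le> rk ?M S" by (rule ge)
      moreover have "card (insert x (J - {e})) = card J"
        using x(2) B(3) eJ finJ by (metis card_Suc_Diff1 card_insert_disjoint finite_Diff Diff_iff subsetD)
      ultimately show False using eq J(3) by simp
    qed
    then show ?thesis using True lower upper by simp
  next
    case False
    obtain B where B: "B \<in> bases M" "sum w B = wt M w" "I \<subseteq> B"
      using I(2) Mw(4) by (auto simp: indep_def)
    have finB: "finite B" using matroidD(4)[OF M B(1)] .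
    have "indep ?M (insert e I)"
    proof (cases "e \<in> B")
      case True
      then show ?thesis using B Mw(4) by (auto simp: indep_def)
    next
      case eB: False
      obtain C where C: "circuit M C" "e \<in> C" "C \<subseteq> insert e B"
        "\<forall>x\<in>C. x \<noteq> e \<longrightarrow> insert e (B - {x}) \<in> bases M"
        using fundamental_circuit[OF M B(1) e(1) eB] .
      have swap: "sum w (insert e (B - {x})) + w x = wt M w + w e" if "x \<in> C" "x \<noteq> e" for x
        using sum_exchange[OF finB _ eB, of x w] that C(3) B(2) by auto
      have "w e \<le> w x" if "x \<in> C" for x
        using swap[of x] sum_le_wt[OF M, of "insert e (B - {x})" w] C(4) that by (cases "x = e") auto
      then have "e \<in> argmin_on w C" using C(2) by (simp add: argmin_on_def)
      then obtain x where x: "x \<in> argmin_on w C" "x \<noteq> e" "x \<notin> S" using False C(1) by blast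
      have xC: "x \<in> C" "w x = w e"
        using x(1) \<open>e \<in> argmin_on w C\<close> by (auto simp: argmin_on_def intro: order_antisym)
      have "insert e (B - {x}) \<in> bases ?M"
        using bspec[OF C(4) xC(1)] x(2) swap[OF xC(1) x(2)] xC(2) Mw(4) by simp
      moreover have "insert e I \<subseteq> insert e (B - {x})" using B(3) x(3) I(1) by blast
      ultimately show ?thesis unfolding indep_def by blast
    qed
    then have "card (insert e I) \<le> rk ?M (insert e S)" using I(1) by (intro ge) auto
    moreover have "card (insert e I) = Suc (rk ?M S)" using I finI e(2) by (simp add: card_insert_if subset_iff) blast
    moreover have "(if \<exists>C. circuit M C \<and> e \<in> argmin_on w C \<and> argmin_on w C \<subseteq> insert e S then 0 else 1) = (1::nat)"
      using False by (rule if_not_P)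
    ultimately show ?thesis using upper by linarith
  qed
qed

lemma rk_empty:
  assumes "bases M \<noteq> {}"
  shows "rk M {} = 0"
proof -
  have "{I. I \<subseteq> {} \<and> indep M I} = {{}}" using assms by (auto simp: indep_def)
  then show ?thesis by (simp add: rk_def)
qed

lemma rk_ground:
  assumes M: "is_matroid M" and B: "B \<in> bases M"
  shows "rk M (ground M) = card B" "rk (initial_matroid M w) (ground M) = card B"
proof -
  have *: "rk N (ground M) = card B"
    if N: "ground N = ground M" "bases N \<subseteq> bases M" "bases N \<noteq> {}" for N
  proof -
    have sub: "finite (ground N)" "\<And>D. D \<in> bases N \<Longrightarrow> D \<subseteq> ground N"
      using matroidD(1,3)[OF M] N(1,2) by auto
    obtain D where D: "D \<in> bases N" using N(3) by blast
    have "card D \<le> rk N (ground M)"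
      using D sub(2)[OF D] N(1) by (intro rk_ge[OF sub]) (auto simp: indep_def)
    moreover obtain I where I: "I \<subseteq> ground M" "indep N I" "card I = rk N (ground M)"
      using rk_obtain[OF sub N(3)] .
    obtain D' where D': "D' \<in> bases N" "I \<subseteq> D'" using I(2) by (auto simp: indep_def)
    have "card I \<le> card D'" using D' N(2) matroidD(4)[OF M] by (intro card_mono) auto
    ultimately show ?thesis
      using matroid_card_bases[OF M _ B] D D' N(2) I(3) by (metis le_antisym subsetD)
  qed
  show "rk M (ground M) = card B" using matroidD(2)[OF M] by (intro *) auto
  show "rk (initial_matroid M w) (ground M) = card B"
    using initial_matroidD(3)[OF M] by (intro *) (auto simp: initial_matroid_def)
qed

text \<open>As \<open>S\<close> lies on the top level \<open>k\<close>, an optimal basis for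
  \<open>w\<close> can be changed to contain a largest independent subset of \<open>S\<close>
  without loss: elements brought in have weight \<open>k\<close>, those removed at most
  \<open>k\<close>, and there are equally many.\<close>

lemma wt_add_indicator:
  assumes M: "is_matroid M" and S: "S \<subseteq> ground M" and k: "\<And>e. e \<in> ground M \<Longrightarrow> w e \<le> k"
    and top: "\<And>e. e \<in> S \<Longrightarrow> w e = k"
  shows "wt M (\<lambda>e. if e \<in> S then Suc (w e) else w e) = wt M w + rk M S"
proof -
  let ?w = "\<lambda>e. if e \<in> S then Suc (w e) else w e"
  have sum_w: "sum ?w B = sum w B + card (B \<inter> S)" if B: "B \<in> bases M" for B
  proof -
    have "sum ?w B = (\<Sum>e\<in>B. w e + (if e \<in> S then 1 else 0))" by (intro sum.cong) auto
    also have "\<dots> = sum w B + card (B \<inter> S)"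
      using matroidD(4)[OF M B] by (simp add: sum.distrib sum.If_cases Int_def)
    finally show ?thesis .
  qed
  show ?thesis
  proof (rule order_antisym)
    obtain B where B: "B \<in> bases M" "sum ?w B = wt M ?w" using wt_obtain[OF M] .
    have "card (B \<inter> S) \<le> rk M S"
      using B(1) matroidD(1,3)[OF M] by (intro rk_ge) (auto simp: indep_def)
    then show "wt M ?w \<le> wt M w + rk M S"
      using sum_w[OF B(1)] sum_le_wt[OF M B(1), of w] B(2) by simp
  next
    obtain I where I: "I \<subseteq> S" "indep M I" "card I = rk M S"
      using rk_obtain[of M S] matroidD(1-3)[OF M] by blast
    obtain B where B: "B \<in> bases M" "sum w B = wt M w" using wt_obtain[OF M] .
    obtain D where D: "D \<in> bases M" "I \<subseteq> D" "D \<subseteq> I \<union> B"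
      using matroid_augment[OF M I(2) B(1)] .
    have fin: "finite B" "finite D" using matroidD(4)[OF M] B(1) D(1) by auto
    have "card (B - D) = card (D - B)"
      using matroid_card_bases[OF M B(1) D(1)] fin
      by (metis Int_commute card_Diff_subset_Int finite_Int)
    moreover have "sum w (B - D) \<le> k * card (B - D)"
      using k matroidD(3)[OF M B(1)] sum_bounded_above[of "B - D" w k] by (auto simp: mult.commute)
    moreover have "sum w (D - B) = k * card (D - B)"
    proof -
      have "sum w (D - B) = (\<Sum>e\<in>D - B. k)" using D(3) I(1) top by (intro sum.cong) auto
      then show ?thesis by simp
    qed
    moreover have "sum w B = sum w (B \<inter> D) + sum w (B - D)" "sum w D = sum w (B \<inter> D) + sum w (D - B)"
      using fin by (metis sum.Int_Diff, metis sum.Int_Diff Int_commute)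
    ultimately have "wt M w \<le> sum w D" using B(2) by simp
    moreover have "rk M S \<le> card (D \<inter> S)" using I D(2) fin by (metis Int_greatest card_mono finite_Int)
    moreover have "sum ?w D \<le> wt M ?w" by (rule sum_le_wt[OF M D(1)])
    ultimately show "wt M w + rk M S \<le> wt M ?w" using sum_w[OF D(1)] by simp
  qed
qed

lemma wt_zero:
  assumes "is_matroid M" "\<And>e. e \<in> ground M \<Longrightarrow> w e = 0"
  shows "wt M w = 0"
proof -
  obtain B where "B \<in> bases M" "sum w B = wt M w" using wt_obtain[OF assms(1)] .
  then show ?thesis using assms(2) matroidD(3)[OF assms(1)] by (metis subsetD sum.neutral)
qed

lemma represents_initial:
  assumes M: "is_matroid M" and circ: "{C. circuit M C} = supp ` \<C>"
  shows "represents (initial w ` \<C>) (ground M) (rk (initial_matroid M w))"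
  unfolding represents_def
proof (intro allI impI ballI)
  fix S e assume S: "S \<subseteq> ground M" "e \<in> ground M - S"
  have "(\<exists>X\<in>initial w ` \<C>. e \<in> supp X \<and> supp X \<subseteq> insert e S) \<longleftrightarrow>
      (\<exists>C\<in>supp ` \<C>. e \<in> argmin_on w C \<and> argmin_on w C \<subseteq> insert e S)"
    by (simp add: supp_initial)
  also have "\<dots> \<longleftrightarrow> (\<exists>C. circuit M C \<and> e \<in> argmin_on w C \<and> argmin_on w C \<subseteq> insert e S)"
    unfolding circ[symmetric] by blast
  finally show "rk (initial_matroid M w) (insert e S) = rk (initial_matroid M w) S +
      (if \<exists>X\<in>initial w ` \<C>. e \<in> supp X \<and> supp X \<subseteq> insert e S then 0 else 1)"
    using rk_initial_insert[OF M, of e S w] S(2) by simp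
qed

lemma represents_rk:
  assumes M: "is_matroid M" and circ: "{C. circuit M C} = supp ` \<C>"
  shows "represents \<C> (ground M) (rk M)"
proof -
  have "initial (\<lambda>_. 0) X = X" for X :: "'a set \<times> 'a set"
    by (auto simp: initial_def argmin_on_def supp_def prod_eq_iff)
  then have "initial (\<lambda>_. 0) ` \<C> = \<C>" by simp
  moreover have "initial_matroid M (\<lambda>_. 0) = M"
    using wt_zero[OF M, of "\<lambda>_. 0"] by (simp add: initial_matroid_def)
  ultimately show ?thesis using represents_initial[OF M circ, of "\<lambda>_. 0"] by simp
qed

section \<open>The weighting of the tope metric\<close>

text \<open>Flipping the signs on \<open>D\<close> moves the tope \<open>D\<close> to the
  all-positive one, which is where the Euler relation applies.\<close>

definition reorient :: "'a set \<Rightarrow> 'a set \<times> 'a set \<Rightarrow> 'a set \<times> 'a set" where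
  "reorient D X = ((fst X - D) \<union> (snd X \<inter> D), (snd X - D) \<union> (fst X \<inter> D))"

lemma supp_reorient [simp]: "supp (reorient D X) = supp X"
  by (auto simp: reorient_def supp_def)

lemma reorient_swap: "reorient D (prod.swap X) = prod.swap (reorient D X)"
  by (auto simp: reorient_def prod_eq_iff)

lemma initial_reorient: "initial w (reorient D X) = reorient D (initial w X)"
  unfolding initial_def supp_reorient by (auto simp: reorient_def prod_eq_iff)

lemma conforms_reorient: "conforms N (reorient D X) \<longleftrightarrow> conforms (sym_diff N D) X"
  by (auto simp: conforms_def reorient_def)

lemma topes_reorient:
  assumes "D \<subseteq> E" "N \<subseteq> E"
  shows "N \<in> topes E (initial w ` reorient D ` \<C>) \<longleftrightarrow> sym_diff N D \<in> topes E (initial w ` \<C>)"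
  using assms unfolding topes_def by (auto simp: initial_reorient conforms_reorient)

lemma oriented_matroid_reorient:
  assumes om: "oriented_matroid E \<C>"
  shows "oriented_matroid E (reorient D ` \<C>)"
proof -
  note es = oriented_matroid_imp_elim_system[OF om]
  have "\<exists>Z\<in>reorient D ` \<C>. fst Z \<subseteq> (fst (reorient D X) \<union> fst (reorient D Y)) - {e} \<and>
      snd Z \<subseteq> (snd (reorient D X) \<union> snd (reorient D Y)) - {e}"
    if X: "X \<in> \<C>" and Y: "Y \<in> \<C>" and ne: "reorient D X \<noteq> prod.swap (reorient D Y)"
      and e: "e \<in> fst (reorient D X)" "e \<in> snd (reorient D Y)" for X Y e
  proof -
    have ne': "X \<noteq> prod.swap Y" using ne by (metis reorient_swap)
    then have ne'': "Y \<noteq> prod.swap X" by (auto simp: eq_swap_iff)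
    have "\<exists>Z\<in>\<C>. fst Z \<subseteq> (fst X \<union> fst Y) - {e} \<and> snd Z \<subseteq> (snd X \<union> snd Y) - {e}"
    proof (cases "e \<in> D")
      case True
      then have "e \<in> fst Y" "e \<in> snd X" using e by (auto simp: reorient_def)
      then obtain Z where "Z \<in> \<C>" "fst Z \<subseteq> (fst Y \<union> fst X) - {e}" "snd Z \<subseteq> (snd Y \<union> snd X) - {e}"
        by (rule elim_system_elim[OF es Y X ne''])
      then show ?thesis by (auto simp: Un_commute)
    next
      case False
      then have "e \<in> fst X" "e \<in> snd Y" using e by (auto simp: reorient_def)
      then obtain Z where "Z \<in> \<C>" "fst Z \<subseteq> (fst X \<union> fst Y) - {e}" "snd Z \<subseteq> (snd X \<union> snd Y) - {e}"
        by (rule elim_system_elim[OF es X Y ne'])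
      then show ?thesis by blast
    qed
    then obtain Z where Z: "Z \<in> \<C>" "fst Z \<subseteq> (fst X \<union> fst Y) - {e}" "snd Z \<subseteq> (snd X \<union> snd Y) - {e}"
      by blast
    then have "fst (reorient D Z) \<subseteq> (fst (reorient D X) \<union> fst (reorient D Y)) - {e}"
      "snd (reorient D Z) \<subseteq> (snd (reorient D X) \<union> snd (reorient D Y)) - {e}"
      unfolding reorient_def fst_conv snd_conv by blast+
    with Z(1) show ?thesis by blast
  qed
  note * = this
  have elim: "\<forall>X\<in>reorient D ` \<C>. \<forall>Y\<in>reorient D ` \<C>. \<forall>e. X \<noteq> prod.swap Y \<and> e \<in> fst X \<inter> snd Y \<longrightarrow>
      (\<exists>Z\<in>reorient D ` \<C>. fst Z \<subseteq> (fst X \<union> fst Y) - {e} \<and> snd Z \<subseteq> (snd X \<union> snd Y) - {e})"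
  proof (intro ballI allI impI)
    fix U V e assume "U \<in> reorient D ` \<C>" "V \<in> reorient D ` \<C>"
      and UV: "U \<noteq> prod.swap V \<and> e \<in> fst U \<inter> snd V"
    then obtain X Y where XY: "X \<in> \<C>" "U = reorient D X" "Y \<in> \<C>" "V = reorient D Y" by blast
    show "\<exists>Z\<in>reorient D ` \<C>. fst Z \<subseteq> (fst U \<union> fst V) - {e} \<and> snd Z \<subseteq> (snd U \<union> snd V) - {e}"
      unfolding XY(2,4) using UV by (intro *[OF XY(1,3)]) (auto simp: XY(2,4))
  qed
  have fin: "finite E" and sub: "\<forall>X\<in>\<C>. supp X \<subseteq> E \<and> fst X \<inter> snd X = {}"
    and min: "\<forall>X\<in>\<C>. \<forall>Y\<in>\<C>. supp X \<subseteq> supp Y \<longrightarrow> X = Y \<or> X = prod.swap Y"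
    using om unfolding oriented_matroid_def by - (elim conjE; assumption)+
  have "\<forall>X\<in>reorient D ` \<C>. supp X \<subseteq> E \<and> fst X \<inter> snd X = {}"
  proof
    fix U assume "U \<in> reorient D ` \<C>"
    then obtain X where X: "X \<in> \<C>" "U = reorient D X" by blast
    show "supp U \<subseteq> E \<and> fst U \<inter> snd U = {}"
      using bspec[OF sub X(1)] by (auto simp: X(2)) (auto simp: reorient_def)
  qed
  moreover have "({}, {}) \<notin> reorient D ` \<C>"
  proof
    assume "({}, {}) \<in> reorient D ` \<C>"
    then obtain X where "X \<in> \<C>" "({}, {}) = reorient D X" by blast
    moreover from this(2) have "supp X = {}"
      using supp_reorient[of D X] by (metis Un_empty fst_conv snd_conv supp_def)
    ultimately show False using elim_systemD(2)[OF es] by blast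
  qed
  moreover have "\<forall>X\<in>reorient D ` \<C>. prod.swap X \<in> reorient D ` \<C>"
    using elim_systemD(3)[OF es] by (auto simp: reorient_swap[symmetric])
  moreover have "\<forall>X\<in>reorient D ` \<C>. \<forall>Y\<in>reorient D ` \<C>. supp X \<subseteq> supp Y \<longrightarrow> X = Y \<or> X = prod.swap Y"
  proof (intro ballI impI)
    fix U V assume "U \<in> reorient D ` \<C>" "V \<in> reorient D ` \<C>" and le: "supp U \<subseteq> supp V"
    then obtain X Y where XY: "X \<in> \<C>" "U = reorient D X" "Y \<in> \<C>" "V = reorient D Y" by blast
    then have "X = Y \<or> X = prod.swap Y" using min le by simp
    then show "U = V \<or> U = prod.swap V" using XY by (auto simp: reorient_swap)
  qed
  ultimately show ?thesis
    using fin elim unfolding oriented_matroid_def by (intro conjI)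
qed

lemma oriented_matroid_supp: "oriented_matroid E \<C> \<Longrightarrow> X \<in> \<C> \<Longrightarrow> supp X \<subseteq> E"
  unfolding oriented_matroid_def by auto

lemma topes_initial_subset: "topes E (initial w ` \<C>) \<subseteq> topes E \<C>"
proof -
  have "conforms N (initial w X)" if "conforms N X" for N X
    using that by (auto simp: conforms_def initial_def)
  then show ?thesis by (auto simp: topes_def)
qed

text \<open>The substitution is \<open>a = w + 1_D\<close>. Positivity of \<open>a\<close> on
  \<open>D\<close> makes the truncated subtraction in \<open>lower\<close> exact and forces
  \<open>card D \<le> n\<close>, whence the default value zero.\<close>

lemma sum_weights_lower:
  assumes M: "is_matroid M" and D: "D \<subseteq> ground M"
  shows "(if card D \<le> n then \<Sum>w\<in>weights M (n - card D). f w else 0) =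
    (\<Sum>a\<in>{a \<in> weights M n. \<forall>e\<in>D. 0 < a e}. f (lower D a))"
proof -
  have fin: "finite (ground M)" "finite D" using matroidD(1)[OF M] D finite_subset by auto
  have sum_lower: "sum (lower D a) (ground M) + card D = sum a (ground M)" if "\<forall>e\<in>D. 0 < a e" for a
  proof -
    have "sum a (ground M) = (\<Sum>e\<in>ground M. lower D a e + (if e \<in> D then 1 else 0))"
      using that by (intro sum.cong) (auto simp: lower_def)
    also have "\<dots> = sum (lower D a) (ground M) + card D"
      using fin D by (simp add: sum.distrib sum.If_cases Int_absorb1)
    finally show ?thesis by simp
  qed
  show ?thesis
  proof (cases "card D \<le> n")
    case True
    have "(\<Sum>a\<in>{a \<in> weights M n. \<forall>e\<in>D. 0 < a e}. f (lower D a)) = (\<Sum>w\<in>weights M (n - card D). f w)"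
    proof (rule sum.reindex_bij_witness[of _ "\<lambda>w e. if e \<in> D then Suc (w e) else w e" "lower D"])
      fix a assume a: "a \<in> {a \<in> weights M n. \<forall>e\<in>D. 0 < a e}"
      then show "(\<lambda>e. if e \<in> D then Suc (lower D a e) else lower D a e) = a"
        by (auto simp: lower_def fun_eq_iff)
      show "lower D a \<in> weights M (n - card D)"
        using a sum_lower[of a] D by (auto simp: weights_def lower_def PiE_iff extensional_def)
    next
      fix w assume w: "w \<in> weights M (n - card D)"
      let ?a = "\<lambda>e. if e \<in> D then Suc (w e) else w e"
      show l: "lower D ?a = w" by (auto simp: lower_def fun_eq_iff)
      have "sum ?a (ground M) = n" using sum_lower[of ?a] w True by (simp add: l weights_def)
      then show "?a \<in> {a \<in> weights M n. \<forall>e\<in>D. 0 < a e}"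
        using w D by (auto simp: weights_def PiE_iff extensional_def)
    qed simp
    with True show ?thesis by simp
  next
    case False
    have "{a \<in> weights M n. \<forall>e\<in>D. 0 < a e} = {}"
      using False sum_lower by (force simp: weights_def)
    with False show ?thesis by (simp only: sum.empty if_False)
  qed
qed

text \<open>The coefficient of \<open>q ^ n\<close> in the series that is to be the entry of the
  weighting at \<open>N\<close>.\<close>

definition tope_coeff :: "'a matroid \<Rightarrow> ('a set \<times> 'a set) set \<Rightarrow> 'a set \<Rightarrow> nat \<Rightarrow> int" where
  "tope_coeff M \<C> N n =
     (\<Sum>w\<in>weights M n. if N \<in> topes (ground M) (initial w ` \<C>) then (-1) ^ wt M w else 0)"

text \<open>This is coefficient \<open>n\<close> of row \<open>N0\<close> of \<open>V u = 1\<close>.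
  Once \<open>N0\<close> is moved to \<open>{}\<close>, the set \<open>D\<close> separating a tope
  from it is the tope itself. With \<open>a = w + 1_D\<close> as outer variable, all
  \<open>D\<close> in the support of \<open>a\<close> occur together and cancel unless
  \<open>a\<close> is zero.\<close>

lemma sum_tope_coeff_distance:
  assumes M: "is_matroid M" and om: "oriented_matroid (ground M) \<C>"
    and circ: "{C. circuit M C} = supp ` \<C>" and N0: "N0 \<in> topes (ground M) \<C>"
  shows "(\<Sum>N\<in>topes (ground M) \<C>. if card (sym_diff N N0) \<le> n
      then tope_coeff M \<C> N (n - card (sym_diff N N0)) else 0) = (if n = 0 then 1 else 0)"
proof -
  let ?E = "ground M"
  have fin: "finite ?E" by (rule matroidD(1)[OF M])
  have N0E: "N0 \<subseteq> ?E" using N0 by (simp add: topes_def)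
  define \<D> where "\<D> = reorient N0 ` \<C>"
  define g where "g D w = (if D \<in> topes ?E (initial w ` \<D>) then (-1) ^ wt M w else (0 :: int))" for D w
  define h where "h N = (if card (sym_diff N N0) \<le> n
    then tope_coeff M \<C> N (n - card (sym_diff N N0)) else 0)" for N
  have omD: "oriented_matroid ?E \<D>" unfolding \<D>_def by (rule oriented_matroid_reorient[OF om])
  have circD: "{C. circuit M C} = supp ` \<D>" by (simp add: \<D>_def circ image_image)
  have posD: "{} \<in> topes ?E \<D>" using N0 by (auto simp: topes_def \<D>_def conforms_reorient)
  \<comment> \<open>Topes of initial systems are topes, so all other subsets contribute zero.
    Summing over every subset makes the shift by \<open>N0\<close> a bijection.\<close>
  have "(\<Sum>N\<in>topes ?E \<C>. h N) = (\<Sum>N\<in>Pow ?E. h N)"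
  proof (rule sum.mono_neutral_left)
    show "\<forall>N\<in>Pow ?E - topes ?E \<C>. h N = 0"
    proof
      fix N assume "N \<in> Pow ?E - topes ?E \<C>"
      then have "N \<notin> topes ?E (initial w ` \<C>)" for w using topes_initial_subset by blast
      then show "h N = 0" by (simp add: h_def tope_coeff_def)
    qed
  qed (use fin in \<open>auto simp: topes_def\<close>)
  also have "\<dots> = (\<Sum>D\<in>Pow ?E. h (sym_diff D N0))"
    by (rule sum.reindex_bij_witness[of _ "\<lambda>D. sym_diff D N0" "\<lambda>D. sym_diff D N0"])
      (use N0E in \<open>auto intro: arg_cong[of _ _ h]\<close>)
  also have "\<dots> = (\<Sum>D\<in>Pow ?E. \<Sum>a\<in>{a \<in> weights M n. \<forall>e\<in>D. 0 < a e}. g D (lower D a))"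
  proof (rule sum.cong[OF refl])
    fix D assume D: "D \<in> Pow ?E"
    have "sym_diff (sym_diff D N0) N0 = D" by auto
    moreover have "tope_coeff M \<C> (sym_diff D N0) m = (\<Sum>w\<in>weights M m. g D w)" for m
      unfolding tope_coeff_def g_def \<D>_def using D by (simp add: topes_reorient[OF N0E])
    ultimately have "h (sym_diff D N0) = (if card D \<le> n then \<Sum>w\<in>weights M (n - card D). g D w else 0)"
      unfolding h_def by (simp only:)
    then show "h (sym_diff D N0) = (\<Sum>a\<in>{a \<in> weights M n. \<forall>e\<in>D. 0 < a e}. g D (lower D a))"
      using sum_weights_lower[OF M PowD[OF D]] by (rule trans)
  qed
  also have "\<dots> = (\<Sum>a\<in>weights M n. \<Sum>D\<in>{D \<in> Pow ?E. \<forall>e\<in>D. 0 < a e}. g D (lower D a))"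
    by (rule sum.swap_restrict) (use fin finite_weights[OF M] in auto)
  also have "\<dots> = (\<Sum>a\<in>weights M n. \<Sum>D\<in>Pow {e \<in> ?E. 0 < a e}. g D (lower D a))"
    by (intro sum.cong refl) auto
  also have "\<dots> = (\<Sum>a\<in>weights M n. if n = 0 then 1 else 0)"
  proof (rule sum.cong[OF refl])
    fix a assume a: "a \<in> weights M n"
    show "(\<Sum>D\<in>Pow {e \<in> ?E. 0 < a e}. g D (lower D a)) = (if n = 0 then 1 else 0)"
    proof (cases "n = 0")
      case True
      then have a0: "a e = 0" if "e \<in> ?E" for e using a that fin by (auto simp: weights_def)
      then have supp0: "{e \<in> ?E. 0 < a e} = {}" by auto
      have "initial a X = X" if "X \<in> \<D>" for X
      proof -
        have "supp X \<subseteq> ?E" by (rule oriented_matroid_supp[OF omD that])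
        then have "argmin_on a (supp X) = supp X" using a0 by (auto simp: argmin_on_def)
        then show ?thesis by (auto simp: initial_def supp_def prod_eq_iff)
      qed
      then have "initial a ` \<D> = \<D>" by simp
      then have "g {} (lower {} a) = 1"
        using posD wt_zero[OF M a0] by (simp add: g_def lower_def)
      then show ?thesis unfolding supp0 using True by simp
    next
      case False
      then have "sum a ?E \<noteq> 0" using a by (simp add: weights_def)
      then obtain e0 where e0: "e0 \<in> ?E" "0 < a e0" by (metis gr0I sum.neutral)
      have "(\<Sum>D\<in>Pow {e \<in> ?E. 0 < a e}. g D (lower D a)) = 0"
        unfolding g_def
      proof (rule sum_lower_topes_eq_0[where W = "wt M" and r = "rk M" and ?e0.0 = e0])
        fix w :: "'a \<Rightarrow> nat" and k S
        assume "S \<subseteq> ?E" "\<And>e. e \<in> ?E \<Longrightarrow> w e \<le> k" "\<And>e. e \<in> S \<Longrightarrow> w e = k"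
        then show "wt M (\<lambda>e. if e \<in> S then Suc (w e) else w e) = wt M w + rk M S"
          by (rule wt_add_indicator[OF M])
      qed (use omD posD represents_rk[OF M circD] e0 in auto)
      then show ?thesis using False by simp
    qed
  qed
  also have "\<dots> = (if n = 0 then 1 else 0)"
  proof (cases "n = 0")
    case True
    have "weights M 0 = {\<lambda>e\<in>?E. 0}"
      using fin by (auto simp: weights_def PiE_iff extensional_def fun_eq_iff)
    then show ?thesis using True by simp
  qed simp
  finally show ?thesis unfolding h_def .
qed

lemma sum_tope_coeff:
  assumes M: "is_matroid M" and om: "oriented_matroid (ground M) \<C>"
    and circ: "{C. circuit M C} = supp ` \<C>"
  shows "(\<Sum>N\<in>topes (ground M) \<C>. tope_coeff M \<C> N n) = (\<Sum>w\<in>weights M n. (-1) ^ wt M w *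
    (\<Sum>S\<in>Pow (ground M). (-1) ^ (card S + rk (initial_matroid M w) S)))"
proof -
  let ?E = "ground M"
  have fin: "finite ?E" by (rule matroidD(1)[OF M])
  then have finT: "finite (topes ?E \<C>)" by (auto simp: topes_def)
  have "(\<Sum>N\<in>topes ?E \<C>. tope_coeff M \<C> N n) = (\<Sum>w\<in>weights M n. \<Sum>N\<in>topes ?E \<C>.
      if N \<in> topes ?E (initial w ` \<C>) then (-1) ^ wt M w else 0)"
    unfolding tope_coeff_def by (rule sum.swap)
  also have "\<dots> = (\<Sum>w\<in>weights M n. (-1) ^ wt M w *
    (\<Sum>S\<in>Pow ?E. (-1) ^ (card S + rk (initial_matroid M w) S)))"
  proof (rule sum.cong[OF refl])
    fix w assume "w \<in> weights M n"
    have "{N \<in> topes ?E \<C>. N \<in> topes ?E (initial w ` \<C>)} = topes ?E (initial w ` \<C>)"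
      using topes_initial_subset by blast
    then have "(\<Sum>N\<in>topes ?E \<C>. if N \<in> topes ?E (initial w ` \<C>) then (-1) ^ wt M w else (0 :: int)) =
        (-1) ^ wt M w * int (card (topes ?E (initial w ` \<C>)))"
      using finT by (simp add: sum.If_cases Int_def)
    also have "int (card (topes ?E (initial w ` \<C>))) =
        (\<Sum>S\<in>Pow ?E. (-1) ^ (card S + rk (initial_matroid M w) S))"
    proof (subst card_topes[OF fin elim_system_initial[OF om] _ represents_initial[OF M circ]])
      fix X assume "X \<in> initial w ` \<C>"
      then obtain Y where Y: "Y \<in> \<C>" "X = initial w Y" by blast
      have "supp Y \<subseteq> ?E" by (rule oriented_matroid_supp[OF om Y(1)])
      then show "supp X \<subseteq> ?E" by (auto simp: Y(2) supp_initial argmin_on_def)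
    qed (simp add: rk_empty[OF initial_matroidD(3)[OF M]])
    finally show "(\<Sum>N\<in>topes ?E \<C>. if N \<in> topes ?E (initial w ` \<C>) then (-1) ^ wt M w else (0 :: int)) =
      (-1) ^ wt M w * (\<Sum>S\<in>Pow ?E. (-1) ^ (card S + rk (initial_matroid M w) S))" .
  qed
  finally show ?thesis .
qed

text \<open>Simplicity leaves no loop in the contraction by \<open>e\<close>, so the contraction has
  a tope, and this lifts with both signs at \<open>e\<close>. The pair at distance one is what
  produces the pole.\<close>

lemma simple_adjacent_topes:
  assumes om: "oriented_matroid (ground M) \<C>" and circ: "{C. circuit M C} = supp ` \<C>"
    and simple: "simple_matroid M" and e: "e \<in> ground M"
  obtains N where "N \<in> topes (ground M) \<C>" "insert e N \<in> topes (ground M) \<C>" "e \<notin> N"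
proof -
  note es = oriented_matroid_imp_elim_system[OF om]
  have fin: "finite (ground M)" and subE: "\<And>X. X \<in> \<C> \<Longrightarrow> supp X \<subseteq> ground M"
    using om unfolding oriented_matroid_def by auto
  have no: "\<not> supp X \<subseteq> {e, f}" if "X \<in> \<C>" for X f
  proof
    assume sub: "supp X \<subseteq> {e, f}"
    have "circuit M (supp X)" using circ that by blast
    moreover have "supp X \<noteq> {}" by (rule elim_systemD(2)[OF es that])
    then have "supp X = {e} \<or> supp X = {f} \<or> supp X = {e, f}" using sub by blast
    ultimately show False
      using simple unfolding simple_matroid_def by (metis insert_absorb2)
  qed
  then have nl: "\<And>X. X \<in> \<C> \<Longrightarrow> \<not> supp X \<subseteq> {e}" by blast
  define E where "E = ground M - {e}"
  have E: "insert e E = ground M" "e \<notin> E" "finite E" using e fin by (auto simp: E_def)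
  have "topes E (contr {e} \<C>) \<noteq> {}"
  proof (rule topes_nonempty[OF E(3) elim_system_contr_nonloop[OF es nl]])
    fix U assume "U \<in> contr {e} \<C>"
    then obtain X where X: "X \<in> \<C>" "U = (fst X - {e}, snd X - {e})" by (auto simp: contr_def)
    then have U: "supp U = supp X - {e}" by (auto simp: supp_def)
    show "supp U \<subseteq> E" using subE[OF X(1)] by (auto simp: U E_def)
    show "\<not> supp U \<subseteq> {f}" for f using no[OF X(1), of f] by (auto simp: U)
  qed
  then obtain N where "N \<in> topes E (contr {e} \<C>)" by blast
  then have "N \<in> Pow E" "N \<in> topes (insert e E) \<C>" "insert e N \<in> topes (insert e E) \<C>"
    using tope_lift(2)[OF es nl E(2)] by auto
  with E that show ?thesis by auto
qed

section \<open>The kernel of the Hamming distance\<close>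

text \<open>Each element contributes the matrix with rows \<open>(1, q)\<close> and
  \<open>(q, 1)\<close>. Its eigenvectors \<open>(1, 1)\<close> and \<open>(1, -1)\<close> have the
  nonnegative eigenvalues \<open>1 + q\<close> and \<open>1 - q\<close>; hence the split into
  \<open>f + g\<close> and \<open>f - g\<close>.\<close>

lemma hamming_kernel_nonneg:
  fixes f :: "'a set \<Rightarrow> real"
  assumes "finite E" "\<bar>q\<bar> \<le> 1"
  shows "0 \<le> (\<Sum>N\<in>Pow E. \<Sum>N'\<in>Pow E. f N * f N' * q ^ card (sym_diff N N'))"
  using assms(1)
proof (induction E arbitrary: f rule: finite_induct)
  case empty
  then show ?case by simp
next
  case (insert e E)
  define B where "B h = (\<Sum>N\<in>Pow E. \<Sum>N'\<in>Pow E. h N * h N' * q ^ card (sym_diff N N'))"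
    for h :: "'a set \<Rightarrow> real"
  define g where "g N = f (insert e N)" for N
  have "(\<Sum>N\<in>Pow (insert e E). \<Sum>N'\<in>Pow (insert e E). f N * f N' * q ^ card (sym_diff N N')) =
      (\<Sum>N\<in>Pow E. \<Sum>N'\<in>Pow E.
        (1 + q) / 2 * ((f N + g N) * (f N' + g N') * q ^ card (sym_diff N N')) +
        (1 - q) / 2 * ((f N - g N) * (f N' - g N') * q ^ card (sym_diff N N')))"
    unfolding sum_Pow_insert[OF insert.hyps] sum.distrib[symmetric]
  proof (intro sum.cong refl)
    fix N N' assume N: "N \<in> Pow E" "N' \<in> Pow E"
    then have *: "sym_diff (insert e N) (insert e N') = sym_diff N N'"
      "sym_diff N (insert e N') = insert e (sym_diff N N')"
      "sym_diff (insert e N) N' = insert e (sym_diff N N')"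
      using insert.hyps(2) by auto
    have "finite (sym_diff N N')" "e \<notin> sym_diff N N'"
      using N insert.hyps by (auto intro: finite_subset)
    then have "card (insert e (sym_diff N N')) = Suc (card (sym_diff N N'))" by simp
    then show "f N * f N' * q ^ card (sym_diff N N') + f N * f (insert e N') * q ^ card (sym_diff N (insert e N')) +
        (f (insert e N) * f N' * q ^ card (sym_diff (insert e N) N') +
          f (insert e N) * f (insert e N') * q ^ card (sym_diff (insert e N) (insert e N'))) =
      (1 + q) / 2 * ((f N + g N) * (f N' + g N') * q ^ card (sym_diff N N')) +
      (1 - q) / 2 * ((f N - g N) * (f N' - g N') * q ^ card (sym_diff N N'))"
      unfolding * g_def by (simp add: field_simps)
  qed
  also have "\<dots> = (1 + q) / 2 * B (\<lambda>N. f N + g N) + (1 - q) / 2 * B (\<lambda>N. f N - g N)"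
    by (simp add: B_def sum.distrib sum_distrib_left)
  also have "\<dots> \<ge> 0"
    using assms(2) insert.IH[of "\<lambda>N. f N + g N"] insert.IH[of "\<lambda>N. f N - g N"]
    unfolding B_def by (intro add_nonneg_nonneg mult_nonneg_nonneg) auto
  finally show ?case .
qed

text \<open>The kernel form is nonnegative at \<open>p - t * v\<close>, and each term involving
  \<open>p\<close> is evaluated by the equation for \<open>p\<close>. Minimising over
  \<open>t\<close> gives a Cauchy-Schwarz inequality for a possibly degenerate form.\<close>

lemma weighting_inequality:
  fixes p v :: "'a set \<Rightarrow> real"
  assumes E: "finite E" and T: "T \<subseteq> Pow E" and s: "\<bar>s\<bar> \<le> 1"
    and p: "\<And>D. D \<in> T \<Longrightarrow> (\<Sum>N\<in>T. s ^ card (sym_diff N D) * p N) = R"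
  shows "0 \<le> (\<Sum>N\<in>T. p N) * R - 2 * t * R * (\<Sum>N\<in>T. v N) +
    t\<^sup>2 * (\<Sum>N\<in>T. \<Sum>N'\<in>T. v N * v N' * s ^ card (sym_diff N N'))"
proof -
  define K where "K N N' = s ^ card (sym_diff N N')" for N N' :: "'a set"
  have K_sym: "K N N' = K N' N" for N N' by (simp add: K_def Un_commute)
  define f where "f N = (if N \<in> T then p N - t * v N else 0)" for N
  have "0 \<le> (\<Sum>N\<in>Pow E. \<Sum>N'\<in>Pow E. f N * f N' * K N N')"
    unfolding K_def by (rule hamming_kernel_nonneg[OF E s])
  also have "\<dots> = (\<Sum>N\<in>T. \<Sum>N'\<in>T. f N * f N' * K N N')"
  proof -
    have "(\<Sum>N'\<in>Pow E. f N * f N' * K N N') = (\<Sum>N'\<in>T. f N * f N' * K N N')" for N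
      by (rule sum.mono_neutral_right) (use E T in \<open>auto simp: f_def\<close>)
    moreover have "(\<Sum>N\<in>Pow E. \<Sum>N'\<in>T. f N * f N' * K N N') = (\<Sum>N\<in>T. \<Sum>N'\<in>T. f N * f N' * K N N')"
      by (rule sum.mono_neutral_right) (use E T in \<open>auto simp: f_def\<close>)
    ultimately show ?thesis by simp
  qed
  also have "\<dots> = (\<Sum>N\<in>T. \<Sum>N'\<in>T. p N * p N' * K N N' - t * (p N * v N' * K N N') -
      t * (v N * p N' * K N N') + t\<^sup>2 * (v N * v N' * K N N'))"
    by (intro sum.cong refl) (simp add: f_def algebra_simps power2_eq_square)
  also have "\<dots> = (\<Sum>N\<in>T. \<Sum>N'\<in>T. p N * p N' * K N N') - t * (\<Sum>N\<in>T. \<Sum>N'\<in>T. p N * v N' * K N N') -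
      t * (\<Sum>N\<in>T. \<Sum>N'\<in>T. v N * p N' * K N N') + t\<^sup>2 * (\<Sum>N\<in>T. \<Sum>N'\<in>T. v N * v N' * K N N')"
    by (simp add: sum.distrib sum_subtractf sum_distrib_left)
  also have "(\<Sum>N\<in>T. \<Sum>N'\<in>T. p N * p N' * K N N') = (\<Sum>N\<in>T. p N) * R"
  proof -
    have "(\<Sum>N\<in>T. \<Sum>N'\<in>T. p N * p N' * K N N') = (\<Sum>N\<in>T. p N * (\<Sum>N'\<in>T. K N' N * p N'))"
      by (simp add: sum_distrib_left mult_ac K_sym)
    also have "\<dots> = (\<Sum>N\<in>T. p N * R)" using p by (simp add: K_def)
    finally show ?thesis by (simp add: sum_distrib_right)
  qed
  also have "(\<Sum>N\<in>T. \<Sum>N'\<in>T. v N * p N' * K N N') = (\<Sum>N\<in>T. v N) * R"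
  proof -
    have "(\<Sum>N\<in>T. \<Sum>N'\<in>T. v N * p N' * K N N') = (\<Sum>N\<in>T. v N * (\<Sum>N'\<in>T. K N' N * p N'))"
      by (simp add: sum_distrib_left mult_ac K_sym)
    also have "\<dots> = (\<Sum>N\<in>T. v N * R)" using p by (simp add: K_def)
    finally show ?thesis by (simp add: sum_distrib_right)
  qed
  also have "(\<Sum>N\<in>T. \<Sum>N'\<in>T. p N * v N' * K N N') = (\<Sum>N\<in>T. v N) * R"
  proof -
    have "(\<Sum>N\<in>T. \<Sum>N'\<in>T. p N * v N' * K N N') = (\<Sum>N'\<in>T. \<Sum>N\<in>T. p N * v N' * K N N')"
      by (rule sum.swap)
    also have "\<dots> = (\<Sum>N'\<in>T. v N' * (\<Sum>N\<in>T. K N N' * p N))"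
      by (simp add: sum_distrib_left mult_ac)
    also have "\<dots> = (\<Sum>N\<in>T. v N * R)" using p by (simp add: K_def)
    finally show ?thesis by (simp add: sum_distrib_right)
  qed
  finally show ?thesis unfolding K_def by (simp add: algebra_simps)
qed

lemma weighting_ge:
  fixes p :: "'a set \<Rightarrow> real"
  assumes E: "finite E" and T: "T \<subseteq> Pow E" and s: "\<bar>s\<bar> \<le> 1"
    and p: "\<And>D. D \<in> T \<Longrightarrow> (\<Sum>N\<in>T. s ^ card (sym_diff N D) * p N) = R" and D: "D \<in> T"
  shows "R\<^sup>2 \<le> (\<Sum>N\<in>T. p N) * R"
proof -
  have fin: "finite T" using E T finite_subset by blast
  have "(\<Sum>N\<in>T. \<Sum>N'\<in>T. (if N = D then 1 else 0) * (if N' = D then 1 else 0) * s ^ card (sym_diff N N')) =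
      (\<Sum>N\<in>T. if N = D then (\<Sum>N'\<in>T. if N' = D then s ^ card (sym_diff N N') else 0) else 0)"
    by (intro sum.cong refl) (auto intro!: sum.cong)
  also have "\<dots> = 1" using fin D by (simp add: sum.delta)
  \<comment> \<open>For the indicator of \<open>D\<close> the quadratic in \<open>t\<close> has
    leading coefficient one and is least at \<open>t = R\<close>.\<close>
  finally show ?thesis
    using weighting_inequality[OF E T s p, where t = R and v = "\<lambda>N. if N = D then 1 else 0"] fin D
    by (simp add: sum.delta power2_eq_square algebra_simps)
qed

lemma weighting_ge_pair:
  fixes p :: "'a set \<Rightarrow> real"
  assumes E: "finite E" and T: "T \<subseteq> Pow E" and s: "\<bar>s\<bar> < 1"
    and p: "\<And>D. D \<in> T \<Longrightarrow> (\<Sum>N\<in>T. s ^ card (sym_diff N D) * p N) = R"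
    and D: "D \<in> T" "D' \<in> T" "card (sym_diff D D') = 1"
  shows "2 * R\<^sup>2 \<le> (1 + s) * ((\<Sum>N\<in>T. p N) * R)"
proof -
  have fin: "finite T" using E T finite_subset by blast
  have ne: "D \<noteq> D'" using D(3) by auto
  define v where "v N = (if N = D then 1 else 0) + (if N = D' then 1 else (0::real))" for N
  have sum_v: "(\<Sum>N\<in>T. v N * g N) = g D + g D'" for g :: "'a set \<Rightarrow> real"
  proof -
    have "(\<Sum>N\<in>T. v N * g N) = (\<Sum>N\<in>T. (if N = D then g N else 0) + (if N = D' then g N else 0))"
      by (intro sum.cong refl) (auto simp: v_def)
    then show ?thesis using fin D by (simp add: sum.distrib sum.delta)
  qed
  have card': "card (sym_diff D' D) = 1" using D(3) by (simp add: Un_commute)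
  have "(\<Sum>N\<in>T. \<Sum>N'\<in>T. v N * v N' * s ^ card (sym_diff N N')) =
      (\<Sum>N\<in>T. v N * (\<Sum>N'\<in>T. v N' * s ^ card (sym_diff N N')))"
    by (simp add: sum_distrib_left mult.assoc)
  also have "\<dots> = 2 + 2 * s" unfolding sum_v using D(3) card' by simp
  finally have vv: "(\<Sum>N\<in>T. \<Sum>N'\<in>T. v N * v N' * s ^ card (sym_diff N N')) = 2 + 2 * s" .
  have "(\<Sum>N\<in>T. v N) = 2" using sum_v[of "\<lambda>_. 1"] by simp
  moreover have "\<bar>s\<bar> \<le> 1" "0 < 1 + s" using s by auto
  \<comment> \<open>The minimum of the quadratic in \<open>t\<close>, whose leading coefficient is
    now \<open>2 + 2 * s\<close>.\<close>
  moreover define t where "t = R / (1 + s)"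
  ultimately have "0 \<le> (\<Sum>N\<in>T. p N) * R - 2 * t * R * 2 + t\<^sup>2 * (2 + 2 * s)"
    using weighting_inequality[OF E T _ p, where t = t and v = v] vv by simp
  moreover have t: "t * (1 + s) = R" using \<open>0 < 1 + s\<close> by (simp add: t_def)
  have "t\<^sup>2 * (2 + 2 * s) = 2 * t * (t * (1 + s))"
    by (simp add: power2_eq_square algebra_simps)
  ultimately have "2 * t * R \<le> (\<Sum>N\<in>T. p N) * R" unfolding t by (simp add: mult_ac)
  then have "(1 + s) * (2 * t * R) \<le> (1 + s) * ((\<Sum>N\<in>T. p N) * R)"
    using \<open>0 < 1 + s\<close> by (intro mult_left_mono) auto
  moreover have "(1 + s) * (2 * t * R) = 2 * (t * (1 + s)) * R" by (simp add: algebra_simps)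
  ultimately show ?thesis unfolding t by (simp add: power2_eq_square)
qed

section \<open>Polynomial solutions\<close>

text \<open>Cramer's rule by bordering: \<open>y\<close> solves the smaller system for
  \<open>b\<close>, \<open>z\<close> solves it for the new column, and \<open>s\<close> is the Schur
  complement of the new entry, cleared of its denominator \<open>c\<close>. The constant terms of
  \<open>V\<close> form an identity matrix, so \<open>s\<close> again has constant term one.\<close>

lemma polynomial_system_solvable:
  fixes V :: "'b \<Rightarrow> 'b \<Rightarrow> int poly" and b :: "'b \<Rightarrow> int poly"
  assumes "finite T"
    and "\<And>i j. i \<in> T \<Longrightarrow> j \<in> T \<Longrightarrow> poly (V i j) 0 = (if i = j then 1 else 0)"
  shows "\<exists>x d. poly d 0 = 1 \<and> (\<forall>i\<in>T. (\<Sum>j\<in>T. V i j * x j) = d * b i)"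
  using assms
proof (induction T arbitrary: b rule: finite_induct)
  case empty
  show ?case by (rule exI, rule exI[of _ 1]) simp
next
  case (insert t T b)
  have V: "poly (V i j) 0 = (if i = j then 1 else 0)" if "i \<in> T" "j \<in> T" for i j
    using insert.prems that by simp
  obtain y d where d: "poly d 0 = 1" and y: "\<And>i. i \<in> T \<Longrightarrow> (\<Sum>j\<in>T. V i j * y j) = d * b i"
    using insert.IH[OF V, of b] by auto
  obtain z c where c: "poly c 0 = 1" and z: "\<And>i. i \<in> T \<Longrightarrow> (\<Sum>j\<in>T. V i j * z j) = c * V i t"
    using insert.IH[OF V, of "\<lambda>i. V i t"] by auto
  define s where "s = c * V t t - (\<Sum>j\<in>T. V t j * z j)"
  define \<beta> where "\<beta> = d * b t - (\<Sum>j\<in>T. V t j * y j)"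
  define x where "x j = (if j = t then c * \<beta> else s * y j - \<beta> * z j)" for j
  have "poly (\<Sum>j\<in>T. V t j * z j) 0 = 0"
    using insert.prems insert.hyps by (auto simp: poly_sum intro!: sum.neutral)
  then have s: "poly s 0 = 1" using c insert.prems by (simp add: s_def)
  have sum_x: "(\<Sum>j\<in>insert t T. V i j * x j) =
      V i t * (c * \<beta>) + (s * (\<Sum>j\<in>T. V i j * y j) - \<beta> * (\<Sum>j\<in>T. V i j * z j))" for i
  proof -
    have "(\<Sum>j\<in>T. V i j * x j) = (\<Sum>j\<in>T. s * (V i j * y j) - \<beta> * (V i j * z j))"
      using insert.hyps by (intro sum.cong refl) (auto simp: x_def algebra_simps)
    then show ?thesis using insert.hyps by (simp add: x_def sum_subtractf sum_distrib_left)
  qed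
  have "(\<Sum>j\<in>insert t T. V i j * x j) = (d * s) * b i" if "i \<in> insert t T" for i
  proof (cases "i = t")
    case True
    have "V t t * (c * \<beta>) + (s * (\<Sum>j\<in>T. V t j * y j) - \<beta> * (\<Sum>j\<in>T. V t j * z j)) =
        \<beta> * s + s * (\<Sum>j\<in>T. V t j * y j)"
      by (simp add: s_def algebra_simps)
    also have "\<dots> = (d * s) * b t" by (simp add: \<beta>_def algebra_simps)
    finally show ?thesis unfolding sum_x True .
  next
    case False
    then have "i \<in> T" using that by simp
    then show ?thesis unfolding sum_x y[OF \<open>i \<in> T\<close>] z[OF \<open>i \<in> T\<close>] by (simp add: algebra_simps)
  qed
  moreover have "poly (d * s) 0 = 1" using d s by simp
  ultimately show ?case by blast
qed

text \<open>Distinct sets have positive distance, so in coefficient \<open>n\<close> of row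
  \<open>D\<close> all unknowns except \<open>z D\<close> enter with smaller index and vanish by
  induction.\<close>

lemma fps_hamming_system_unique:
  fixes z :: "'a set \<Rightarrow> rat fps"
  assumes E: "finite E" and T: "T \<subseteq> Pow E"
    and z: "\<And>D. D \<in> T \<Longrightarrow> (\<Sum>N\<in>T. fps_X ^ card (sym_diff N D) * z N) = 0" and D: "D \<in> T"
  shows "z D = 0"
proof -
  have fin: "finite T" using E T finite_subset by blast
  have "fps_nth (z D) n = 0" if "D \<in> T" for n D
    using that
  proof (induction n arbitrary: D rule: less_induct)
    case (less n)
    have "0 = fps_nth (\<Sum>N\<in>T. fps_X ^ card (sym_diff N D) * z N) n"
      using z[OF less.prems] by simp
    also have "\<dots> = (\<Sum>N\<in>T. if N = D then fps_nth (z D) n else 0)"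
      unfolding fps_sum_nth
    proof (intro sum.cong refl)
      fix N assume N: "N \<in> T"
      have "finite (sym_diff N D)" using N less.prems T E by (auto intro: finite_subset)
      then have "0 < card (sym_diff N D)" if "N \<noteq> D" using that by (auto simp: card_gt_0_iff)
      then show "fps_nth (fps_X ^ card (sym_diff N D) * z N) n = (if N = D then fps_nth (z D) n else 0)"
        using less.IH[OF _ N, of "n - card (sym_diff N D)"]
        by (cases "N = D") (simp_all add: fps_X_power_mult_nth)
    qed
    also have "\<dots> = fps_nth (z D) n" using fin less.prems by simp
    finally show ?case by simp
  qed
  with D show ?thesis by (simp add: fps_eq_iff)
qed

text \<open>Coprime integer polynomials, such as \<open>2\<close> and \<open>q\<close>, need not
  generate \<open>1\<close>; the claim is Bezout up to a constant. Pseudo-division by a nonzero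
  combination \<open>d\<close> of least degree shows that its primitive part divides both
  \<open>P\<close> and \<open>Q\<close>, so \<open>d\<close> is constant.\<close>

lemma coprime_int_poly_combination:
  fixes P Q :: "int poly"
  assumes "coprime P Q"
  obtains a b c where "c \<noteq> 0" "a * P + b * Q = [:c:]"
proof -
  define I where "I d \<longleftrightarrow> d \<noteq> 0 \<and> (\<exists>a b. d = a * P + b * Q)" for d
  have "P \<noteq> 0 \<or> Q \<noteq> 0" using assms by auto
  then have "\<exists>d. I d" unfolding I_def by (metis add.right_neutral add.left_neutral mult_1 mult_zero_left)
  then obtain d where d: "I d" and min: "\<And>d'. I d' \<Longrightarrow> degree d \<le> degree d'"
    using ex_has_least_nat[of I _ degree] by blast
  obtain a b where ab: "d = a * P + b * Q" and d0: "d \<noteq> 0" using d by (auto simp: I_def)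
  have "primitive_part d dvd X" if X: "\<exists>a b. X = a * P + b * Q" for X
  proof -
    obtain q r where qr: "pseudo_divmod X d = (q, r)" by (cases "pseudo_divmod X d")
    define c where "c = lead_coeff d ^ (Suc (degree X) - degree d)"
    have c: "smult c X = d * q + r" "r = 0 \<or> degree r < degree d"
      using pseudo_divmod[OF d0 qr] by (auto simp: c_def)
    have c0: "c \<noteq> 0" using d0 by (simp add: c_def)
    obtain a' b' where X': "X = a' * P + b' * Q" using X by blast
    have "r = smult c X - d * q" using c(1) by simp
    also have "\<dots> = (smult c a' - a * q) * P + (smult c b' - b * q) * Q"
      by (simp add: X' ab algebra_simps smult_add_right)
    finally have "r = 0" using c(2) min[of r] unfolding I_def by (metis not_less)
    then have "d dvd smult c X" using c(1) by simp
    moreover have "primitive_part d dvd d"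
      by (metis content_times_primitive_part dvd_smult dvd_refl)
    ultimately have "primitive_part d dvd smult c X" by (rule dvd_trans[rotated])
    \<comment> \<open>Gauss's lemma: \<open>c\<close> is cancelled over the fraction field, and
      divisibility by a primitive polynomial descends to the integers.\<close>
    then have "fract_poly (primitive_part d) dvd smult (to_fract c) (fract_poly X)"
      using fract_poly_dvd[of "primitive_part d" "smult c X"] by simp
    then have "fract_poly (primitive_part d) dvd fract_poly X"
      using c0 by (simp add: dvd_smult_iff)
    then show ?thesis using d0 by (intro fract_poly_dvdD) auto
  qed
  from this[of P] this[of Q] have "primitive_part d dvd P" "primitive_part d dvd Q"
    by (metis add.right_neutral mult_1 mult_zero_left, metis add.left_neutral mult_1 mult_zero_left)
  then have "is_unit (primitive_part d)" using assms by (meson coprime_common_divisor)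
  then have "degree d = 0" by (metis degree_primitive_part is_unit_iff_degree is_unit_poly_iff degree_pCons_0)
  then obtain c where "d = [:c:]" by (metis degree_eq_zeroE)
  with d0 ab that show ?thesis by (metis pCons_0_0)
qed

section \<open>The magnitude as a rational function\<close>

lemma map_poly_of_int_mult:
  "map_poly of_int (p * q) = (map_poly of_int p * map_poly of_int q :: 'a :: comm_ring_1 poly)"
  by (rule poly_eqI) (simp add: coeff_map_poly coeff_mult)

lemma map_poly_of_int_add:
  "map_poly of_int (p + q) = (map_poly of_int p + map_poly of_int q :: 'a :: comm_ring_1 poly)"
  by (rule poly_eqI) (simp add: coeff_map_poly)

lemma map_poly_of_int_sum:
  "map_poly of_int (\<Sum>i\<in>A. f i) = (\<Sum>i\<in>A. map_poly of_int (f i) :: 'a :: comm_ring_1 poly)"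
  by (rule poly_eqI) (simp add: coeff_map_poly coeff_sum)

lemma poly_map_poly_of_int:
  "poly (map_poly of_int p) (of_int k :: 'a :: comm_ring_1) = of_int (poly p k)"
  by (induction p) (auto simp: map_poly_pCons)

text \<open>At \<open>x = -1\<close> the sign \<open>(-1) ^ rk M (ground M)\<close> occurs once in
  the characteristic polynomial, since initial matroids keep the rank, and once in the power of
  \<open>x\<close>; the two cancel.\<close>

lemma magnitude_nth:
  assumes M: "is_matroid M"
  shows "fps_nth (magnitude M) n = of_int (\<Sum>w\<in>weights M n. (-1) ^ wt M w *
    (\<Sum>S\<in>Pow (ground M). (-1) ^ (card S + rk (initial_matroid M w) S)))"
proof -
  have "poly (map_poly of_int (char_poly (initial_matroid M w))) (-1 :: rat) *
      (-1) powi (- int (rk M (ground M)) - int (wt M w)) =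
    of_int ((-1) ^ wt M w * (\<Sum>S\<in>Pow (ground M). (-1) ^ (card S + rk (initial_matroid M w) S)))" for w
  proof -
    let ?M = "initial_matroid M w"
    obtain B where "B \<in> bases M" using matroidD(2)[OF M] by blast
    then have rk_eq: "rk ?M (ground M) = rk M (ground M)" using rk_ground[OF M] by simp
    have rk_le: "rk ?M S \<le> rk ?M (ground M)" if "S \<in> Pow (ground M)" for S
    proof -
      obtain I where "I \<subseteq> S" "indep ?M I" "card I = rk ?M S"
        using rk_obtain[OF initial_matroidD(1,2,3)[OF M]] .
      then show ?thesis
        using that rk_ge[OF initial_matroidD(1,2)[OF M], of w I "ground M"] by auto
    qed
    let ?r = "rk M (ground M)"
    have "poly (map_poly of_int (char_poly ?M)) (-1 :: rat) = of_int (poly (char_poly ?M) (-1))"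
      using poly_map_poly_of_int[of "char_poly ?M" "-1"] by simp
    also have "poly (char_poly ?M) (-1) = (\<Sum>S\<in>Pow (ground M). (-1) ^ card S * (-1) ^ (?r - rk ?M S))"
      by (simp add: char_poly_def initial_matroid_def[of M w] poly_sum poly_monom rk_eq[unfolded initial_matroid_def])
    also have "\<dots> = (\<Sum>S\<in>Pow (ground M). (-1) ^ ?r * (-1) ^ (card S + rk ?M S))"
    proof (intro sum.cong refl)
      fix S assume "S \<in> Pow (ground M)"
      then have le: "rk ?M S \<le> ?r" using rk_le rk_eq by simp
      have "(-1) ^ (?r - rk ?M S) = ((-1) ^ (?r + rk ?M S) :: int)"
        using le by (simp add: neg_one_power_add_eq_neg_one_power_diff)
      then show "(-1) ^ card S * (-1) ^ (?r - rk ?M S) = ((-1) ^ ?r * (-1) ^ (card S + rk ?M S) :: int)"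
        by (simp add: power_add)
    qed
    finally have chi: "poly (map_poly of_int (char_poly ?M)) (-1 :: rat) =
      of_int ((-1) ^ ?r * (\<Sum>S\<in>Pow (ground M). (-1) ^ (card S + rk ?M S)))"
      by (simp add: sum_distrib_left)
    have "- int ?r - int (wt M w) = - int (?r + wt M w)" by simp
    then have "(-1 :: rat) powi (- int ?r - int (wt M w)) = (-1) ^ (?r + wt M w)"
      by (simp only: power_int_minus power_int_of_nat flip: power_inverse) simp
    then show ?thesis unfolding chi by (simp add: power_add)
  qed
  then show ?thesis by (simp add: magnitude_def motivic_zeta_def)
qed

lemma topes_complement:
  assumes "oriented_matroid E \<C>" "N \<in> topes E \<C>"
  shows "E - N \<in> topes E \<C>"
proof -
  note es = oriented_matroid_imp_elim_system[OF assms(1)]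
  have "\<not> conforms (E - N) X" if X: "X \<in> \<C>" for X
  proof
    assume "conforms (E - N) X"
    moreover have "supp X \<subseteq> E" by (rule oriented_matroid_supp[OF assms(1) X])
    ultimately have "conforms N (prod.swap X)" by (auto simp: conforms_def supp_def)
    then show False using assms(2) elim_systemD(3)[OF es X] unfolding topes_def by blast
  qed
  then show ?thesis by (auto simp: topes_def)
qed

text \<open>The polynomial solution \<open>p\<close>, \<open>d\<close> meets the combinatorial
  series \<open>u\<close>: \<open>p - d * u\<close> solves the homogeneous system, so it is
  zero.\<close>

lemma magnitude_fraction:
  assumes M: "is_matroid M" and om: "oriented_matroid (ground M) \<C>"
    and circ: "{C. circuit M C} = supp ` \<C>"
  defines "T \<equiv> topes (ground M) \<C>"
  obtains p :: "'a set \<Rightarrow> int poly" and d :: "int poly" where "poly d 0 = 1"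
    "\<And>D. D \<in> T \<Longrightarrow> (\<Sum>N\<in>T. monom 1 (card (sym_diff N D)) * p N) = d"
    "magnitude M * fps_of_poly (map_poly of_int d) = fps_of_poly (map_poly of_int (\<Sum>N\<in>T. p N))"
proof -
  have finE: "finite (ground M)" by (rule matroidD(1)[OF M])
  have fin: "finite T" using finE by (auto simp: T_def topes_def)
  define V :: "'a set \<Rightarrow> 'a set \<Rightarrow> int poly" where "V N D = monom 1 (card (sym_diff N D))" for N D
  have V_sym: "V N D = V D N" for N D by (simp add: V_def Un_commute)
  have V0: "poly (V N D) 0 = (if N = D then 1 else 0)" if "N \<in> T" "D \<in> T" for N D
  proof -
    have "finite (sym_diff N D)" using that finE by (auto simp: T_def topes_def intro: finite_subset)
    then have "card (sym_diff N D) = 0 \<longleftrightarrow> N = D" by auto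
    then show ?thesis by (simp add: V_def poly_monom power_0_left)
  qed
  obtain p d where d: "poly d 0 = 1" and Vp': "\<And>D. D \<in> T \<Longrightarrow> (\<Sum>N\<in>T. V D N * p N) = d"
    using polynomial_system_solvable[OF fin V0, of "\<lambda>_. 1"] by auto
  have Vp: "(\<Sum>N\<in>T. V N D * p N) = d" if "D \<in> T" for D
    using Vp'[OF that] by (simp add: V_sym[of _ D])
  define \<phi> :: "int poly \<Rightarrow> rat fps" where "\<phi> q = fps_of_poly (map_poly of_int q)" for q
  have \<phi>_mult: "\<phi> (q * q') = \<phi> q * \<phi> q'" for q q'
    by (simp add: \<phi>_def map_poly_of_int_mult fps_of_poly_mult)
  have \<phi>_sum: "\<phi> (\<Sum>i\<in>I. f i) = (\<Sum>i\<in>I. \<phi> (f i))" for I :: "'a set set" and f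
    by (simp add: \<phi>_def map_poly_of_int_sum fps_of_poly_sum)
  have \<phi>_V: "\<phi> (V N D) = fps_X ^ card (sym_diff N D)" for N D
    by (simp add: \<phi>_def V_def map_poly_monom fps_of_poly_monom)
  define u :: "'a set \<Rightarrow> rat fps" where "u N = Abs_fps (\<lambda>n. of_int (tope_coeff M \<C> N n))" for N
  have Vu: "(\<Sum>N\<in>T. fps_X ^ card (sym_diff N D) * u N) = 1" if D: "D \<in> T" for D
  proof (rule fps_ext)
    fix n
    have "fps_nth (\<Sum>N\<in>T. fps_X ^ card (sym_diff N D) * u N) n =
        of_int (\<Sum>N\<in>T. if card (sym_diff N D) \<le> n
          then tope_coeff M \<C> N (n - card (sym_diff N D)) else 0)"
      unfolding fps_sum_nth of_int_sum
      by (intro sum.cong refl) (simp add: fps_X_power_mult_nth u_def)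
    also have "\<dots> = fps_nth 1 n"
      using sum_tope_coeff_distance[OF M om circ, of D n] D by (simp add: T_def)
    finally show "fps_nth (\<Sum>N\<in>T. fps_X ^ card (sym_diff N D) * u N) n = fps_nth 1 n" .
  qed
  have \<phi>_p: "\<phi> (p N) = \<phi> d * u N" if N: "N \<in> T" for N
  proof -
    have "\<phi> (p N) - \<phi> d * u N = 0"
    proof (rule fps_hamming_system_unique[OF finE _ _ N, where z = "\<lambda>N. \<phi> (p N) - \<phi> d * u N"])
      show "T \<subseteq> Pow (ground M)" by (auto simp: T_def topes_def)
      fix D assume D: "D \<in> T"
      have "(\<Sum>N\<in>T. fps_X ^ card (sym_diff N D) * (\<phi> (p N) - \<phi> d * u N)) =
          (\<Sum>N\<in>T. \<phi> (V N D * p N)) - \<phi> d * (\<Sum>N\<in>T. fps_X ^ card (sym_diff N D) * u N)"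
        by (simp add: \<phi>_mult \<phi>_V algebra_simps sum_subtractf sum_distrib_left)
      also have "\<dots> = 0" by (simp add: \<phi>_sum[symmetric] Vp[OF D] Vu[OF D])
      finally show "(\<Sum>N\<in>T. fps_X ^ card (sym_diff N D) * (\<phi> (p N) - \<phi> d * u N)) = 0" .
    qed
    then show ?thesis by simp
  qed
  have "magnitude M = (\<Sum>N\<in>T. u N)"
  proof (rule fps_ext)
    fix n
    show "fps_nth (magnitude M) n = fps_nth (\<Sum>N\<in>T. u N) n"
      unfolding magnitude_nth[OF M] sum_tope_coeff[OF M om circ, symmetric]
      by (simp add: fps_sum_nth u_def T_def)
  qed
  then have "magnitude M * \<phi> d = \<phi> (\<Sum>N\<in>T. p N)"
    by (simp add: \<phi>_sum \<phi>_p sum_distrib_left mult.commute)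
  with d Vp that show ?thesis unfolding V_def \<phi>_def by blast
qed

section \<open>Real roots of the reduced fraction\<close>

text \<open>If \<open>h\<close> were negative at \<open>x\<close>, it would be negative at
  infinitely many points of \<open>S\<close>, and each of them would be a root of
  \<open>g\<close>.\<close>

lemma poly_nonneg_limit:
  fixes g h :: "real poly"
  assumes g: "g \<noteq> 0" and x: "x islimpt S" and S: "\<And>y. y \<in> S \<Longrightarrow> 0 \<le> (poly g y)\<^sup>2 * poly h y"
  shows "0 \<le> poly h x"
proof (rule ccontr)
  assume "\<not> ?thesis"
  then have "poly h x < 0" by simp
  moreover have "(poly h \<longlongrightarrow> poly h x) (at x)"
    using poly_isCont isCont_def by blast
  ultimately have "eventually (\<lambda>y. poly h y < 0) (at x)" by (rule order_tendstoD(2)[rotated])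
  then have "x islimpt S \<inter> {y. poly h y < 0}"
    using x by (intro islimpt_Int_eventually) auto
  then have "infinite (S \<inter> {y. poly h y < 0})" by (metis islimpt_finite)
  moreover have "S \<inter> {y. poly h y < 0} \<subseteq> {y. poly g y = 0}"
    using S by (force simp: zero_le_mult_iff)
  ultimately show False using poly_roots_finite[OF g] finite_subset by blast
qed

lemma coprime_no_common_root:
  fixes x :: "'a :: {comm_ring_1, ring_char_0}"
  assumes "coprime P Q" "poly (map_poly of_int P) x = 0"
  shows "poly (map_poly of_int Q) x \<noteq> 0"
proof
  assume Q: "poly (map_poly of_int Q) x = 0"
  obtain a b c where c: "c \<noteq> 0" "a * P + b * Q = [:c:]"
    using coprime_int_poly_combination[OF assms(1)] .
  have "poly (map_poly of_int (a * P + b * Q)) x = 0"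
    using assms(2) Q by (simp add: map_poly_of_int_add map_poly_of_int_mult)
  then show False using c by (simp add: map_poly_pCons)
qed

text \<open>Cancelling the square of \<open>G\<close> and passing to the limit over its roots turns
  the inequality into one for \<open>P\<close> and \<open>Q\<close> at \<open>x\<close>; a root of
  \<open>P\<close> would then be a root of \<open>Q\<close>. A connected set with two points makes
  every \<open>x\<close> in it a limit point, endpoints included. The factor \<open>k\<close>
  carries the power of \<open>q\<close> that arises for
  \<open>\<bar>q\<bar> \<ge> 1\<close>.\<close>

lemma reduced_numerator_nonzero:
  fixes x :: real and k :: "real poly"
  assumes cop: "coprime P Q" and G: "G \<noteq> 0"
    and S: "connected S" "a \<in> S" "b \<in> S" "a \<noteq> b" "x \<in> S"
    and ineq: "\<And>y. y \<in> S \<Longrightarrow> (poly (map_poly of_int (Q * G)) y)\<^sup>2 \<le>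
      poly (map_poly of_int (P * G)) y * poly (map_poly of_int (Q * G)) y * poly k y"
  shows "poly (map_poly of_int P) x \<noteq> 0"
proof
  assume P: "poly (map_poly of_int P) x = 0"
  let ?h = "map_poly of_int P * map_poly of_int Q * k - map_poly of_int Q ^ 2"
  have "0 \<le> poly ?h x"
  proof (rule poly_nonneg_limit)
    show "map_poly of_int G \<noteq> (0 :: real poly)"
      using G by (auto simp: poly_eq_iff coeff_map_poly)
    show "x islimpt S" using S by (intro connected_imp_perfect) auto
    show "0 \<le> (poly (map_poly of_int G) y)\<^sup>2 * poly ?h y" if "y \<in> S" for y
      using ineq[OF that] by (simp add: map_poly_of_int_mult power2_eq_square algebra_simps)
  qed
  then have "poly (map_poly of_int Q) x = 0" using P by simp
  then show False using coprime_no_common_root[OF cop P] by simp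
qed

lemma lowest_terms_exists:
  assumes d: "poly d 0 = 1"
    and F: "F * fps_of_poly (map_poly of_int d) = fps_of_poly (map_poly of_int p)"
  obtains P Q G :: "int poly" where "lowest_terms F P Q" "p = P * G" "d = Q * G" "G \<noteq> 0"
proof -
  have "d \<noteq> 0" using d by auto
  then have "gcd p d \<noteq> 0" by simp
  then obtain P' Q' where PQ: "p = P' * gcd p d" "d = Q' * gcd p d" "coprime P' Q'"
    using gcd_coprime_exists by blast
  define c where "c = poly Q' 0"
  \<comment> \<open>The constant terms are integers with product one, so a change of sign suffices
    to give the denominator constant term one.\<close>
  have "c * poly (gcd p d) 0 = 1" using d PQ(2) by (metis c_def poly_mult)
  then have c: "c = 1 \<or> c = - 1" by (metis zmult_eq_1_iff)
  define P Q G where "P = smult c P'" and "Q = smult c Q'" and "G = smult c (gcd p d)"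
  have cc: "c * c = 1" using c by auto
  have p: "p = P * G" and dQ: "d = Q * G"
    using PQ(1,2) cc by (simp_all add: P_def Q_def G_def)
  have G0: "poly G 0 \<noteq> 0" using d dQ by auto
  have cop: "coprime P Q" using PQ(3) c by (auto simp: P_def Q_def)
  have "poly Q 0 = 1" using cc by (simp add: Q_def c_def)
  then have Q0: "coeff Q 0 = 1" by (simp add: poly_0_coeff_0)
  have "(F * fps_of_poly (map_poly of_int Q)) * fps_of_poly (map_poly of_int G) =
      fps_of_poly (map_poly of_int P) * fps_of_poly (map_poly of_int G)"
    using F by (simp add: p dQ map_poly_of_int_mult fps_of_poly_mult mult.assoc)
  moreover have "fps_of_poly (map_poly of_int G :: rat poly) \<noteq> 0"
    using G0 by (auto simp: poly_0_coeff_0 poly_eq_iff coeff_map_poly)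
  ultimately have "F * fps_of_poly (map_poly of_int Q) = fps_of_poly (map_poly of_int P)" by simp
  with cop Q0 have "lowest_terms F P Q" by (simp add: lowest_terms_def)
  moreover have "G \<noteq> 0" using G0 by auto
  ultimately show ?thesis using that p dQ by blast
qed

lemma is_pole_quotient:
  fixes P Q :: "int poly"
  assumes cop: "coprime P Q" and Q: "Q \<noteq> 0" "poly Q k = 0"
  shows "is_pole (\<lambda>q :: complex. poly (map_poly of_int P) q / poly (map_poly of_int Q) q) (of_int k)"
proof (rule is_pole_divide)
  let ?P = "map_poly of_int P :: complex poly" and ?Q = "map_poly of_int Q :: complex poly"
  show "isCont (poly ?P) (of_int k)" by (rule poly_isCont)
  have Qk: "poly ?Q (of_int k) = 0" using Q(2) by (simp add: poly_map_poly_of_int)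
  have "coprime Q P" using cop by (simp add: coprime_commute)
  then show "poly ?P (of_int k) \<noteq> 0" using Qk by (rule coprime_no_common_root)
  have "?Q \<noteq> 0" using Q(1) by (auto simp: poly_eq_iff coeff_map_poly)
  then have "finite {z. poly ?Q z = 0}" by (rule poly_roots_finite)
  then have "eventually (\<lambda>z. z \<notin> {z. poly ?Q z = 0} - {of_int k}) (at (of_int k))"
    using islimpt_finite[of "{z. poly ?Q z = 0}" "of_int k"]
    by (metis (no_types, lifting) Diff_iff eventually_at_filter eventually_mono insertCI islimpt_iff_eventually)
  then have "eventually (\<lambda>z. poly ?Q z \<noteq> 0) (at (of_int k))"
    by (simp add: eventually_at_filter)
  moreover have "isCont (poly ?Q) (of_int k)" by (rule poly_isCont)
  then have "(poly ?Q \<longlongrightarrow> 0) (at (of_int k))" using Qk by (simp add: isCont_def)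
  ultimately show "filterlim (poly ?Q) (at 0) (at (of_int k))"
    by (simp add: filterlim_at)
qed

theorem corollary4p7:
  fixes M :: "'a matroid"
  assumes "is_matroid M"
    and "ground M \<noteq> {}"
    and "simple_matroid M"
    and "orientable M"
  shows "\<exists>P Q :: int poly. lowest_terms (magnitude M) P Q \<and>
           (\<forall>x :: real. poly (map_poly of_int P) x \<noteq> 0) \<and>
           is_pole (\<lambda>q :: complex. poly (map_poly of_int P) q / poly (map_poly of_int Q) q) (-1)"
proof -
  note M = assms(1)
  let ?E = "ground M"
  obtain \<C> where om: "oriented_matroid ?E \<C>" and circ: "{C. circuit M C} = supp ` \<C>"
    using assms(4) by (auto simp: orientable_def)
  define T where "T = topes ?E \<C>"
  obtain e where e: "e \<in> ?E" using assms(2) by blast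
  obtain N0 where N0: "N0 \<in> T" "insert e N0 \<in> T" "e \<notin> N0"
    using simple_adjacent_topes[OF om circ assms(3) e] unfolding T_def by blast
  have "sym_diff N0 (insert e N0) = {e}" using N0(3) by auto
  then have adj: "card (sym_diff N0 (insert e N0)) = 1" by simp
  have finE: "finite ?E" and TE: "T \<subseteq> Pow ?E"
    using matroidD(1)[OF M] by (auto simp: T_def topes_def)
  obtain p d where d0: "poly d 0 = 1"
    and pd: "\<And>D. D \<in> T \<Longrightarrow> (\<Sum>N\<in>T. monom 1 (card (sym_diff N D)) * p N) = d"
    and mag: "magnitude M * fps_of_poly (map_poly of_int d) = fps_of_poly (map_poly of_int (\<Sum>N\<in>T. p N))"
    using magnitude_fraction[OF M om circ] unfolding T_def by blast
  define ev :: "real \<Rightarrow> int poly \<Rightarrow> real" where "ev x q = poly (map_poly of_int q) x" for x q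
  have ev_sum: "ev x (\<Sum>N\<in>T. f N) = (\<Sum>N\<in>T. ev x (f N))" for x f
    by (simp add: ev_def map_poly_of_int_sum poly_sum)
  have weighting: "(\<Sum>N\<in>T. x ^ card (sym_diff N D) * ev x (p N)) = ev x d" if "D \<in> T" for x D
  proof -
    have "ev x d = (\<Sum>N\<in>T. ev x (monom 1 (card (sym_diff N D)) * p N))"
      using pd[OF that] by (simp add: ev_sum[symmetric])
    then show ?thesis by (simp add: ev_def map_poly_of_int_mult map_poly_monom poly_monom)
  qed
  let ?n = "card ?E"
  let ?p = "\<Sum>N\<in>T. p N"
  obtain P Q G where low: "lowest_terms (magnitude M) P Q" and PQG: "?p = P * G" "d = Q * G" "G \<noteq> 0"
    using lowest_terms_exists[OF d0 mag] .
  have cop: "coprime P Q" using low by (simp add: lowest_terms_def)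
  have small: "(ev x d)\<^sup>2 \<le> ev x ?p * ev x d" if "\<bar>x\<bar> \<le> 1" for x
    unfolding ev_sum by (rule weighting_ge[OF finE TE that weighting N0(1)])
  have large: "(ev x d)\<^sup>2 \<le> ev x ?p * ev x d * x ^ ?n" if x: "1 \<le> \<bar>x\<bar>" for x
  proof -
    have x0: "x \<noteq> 0" using x by auto
    \<comment> \<open>Complementing \<open>D\<close> replaces a distance by \<open>?n\<close> minus
      that distance. So the same vector solves the system at \<open>1 / x\<close>, where the kernel
      is nonnegative, with right-hand side divided by \<open>x ^ ?n\<close>.\<close>
    have inv: "(\<Sum>N\<in>T. (1 / x) ^ card (sym_diff N D) * ev x (p N)) = ev x d / x ^ ?n" if D: "D \<in> T" for D
    proof -
      have D': "?E - D \<in> T" using topes_complement[OF om] D by (simp add: T_def)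
      have "x ^ card (sym_diff N (?E - D)) = x ^ ?n * (1 / x) ^ card (sym_diff N D)" if N: "N \<in> T" for N
      proof -
        have sub: "sym_diff N D \<subseteq> ?E" using N D TE by auto
        have "sym_diff N (?E - D) = ?E - sym_diff N D" using N D TE by auto
        then have "card (sym_diff N (?E - D)) = ?n - card (sym_diff N D)"
          using card_Diff_subset[OF finite_subset[OF sub finE] sub] by simp
        moreover have "card (sym_diff N D) \<le> ?n" by (rule card_mono[OF finE sub])
        ultimately show ?thesis using x0 by (simp add: power_diff power_divide)
      qed
      then have "ev x d = (\<Sum>N\<in>T. x ^ ?n * ((1 / x) ^ card (sym_diff N D) * ev x (p N)))"
        using weighting[OF D', of x] by (simp add: mult.assoc)
      then show ?thesis using x0 by (simp add: sum_distrib_left[symmetric])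
    qed
    have "\<bar>1 / x\<bar> \<le> 1" using x x0 by (simp add: divide_le_eq)
    then have "(ev x d / x ^ ?n)\<^sup>2 \<le> ev x ?p * (ev x d / x ^ ?n)"
      unfolding ev_sum by (rule weighting_ge[OF finE TE _ inv N0(1)])
    then have "(x ^ ?n)\<^sup>2 * (ev x d / x ^ ?n)\<^sup>2 \<le> (x ^ ?n)\<^sup>2 * (ev x ?p * (ev x d / x ^ ?n))"
      by (intro mult_left_mono) auto
    then show ?thesis using x0 by (simp add: power2_eq_square mult_ac)
  qed
  have "poly (map_poly of_int P) x \<noteq> 0" for x :: real
  proof -
    consider "x \<in> {-1..1}" | "x \<in> {1..}" | "x \<in> {..-1}" by fastforce
    then show ?thesis
    proof cases
      case 1
      show ?thesis
        by (rule reduced_numerator_nonzero[OF cop PQG(3), of "{-1..1}" "-1" 1 _ 1])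
          (use 1 small in \<open>auto simp: ev_def PQG(1,2)\<close>)
    next
      case 2
      show ?thesis
        by (rule reduced_numerator_nonzero[OF cop PQG(3), of "{1..}" 1 2 _ "monom 1 ?n"])
          (use 2 large in \<open>auto simp: ev_def PQG(1,2) poly_monom\<close>)
    next
      case 3
      show ?thesis
        by (rule reduced_numerator_nonzero[OF cop PQG(3), of "{..-1}" "-1" "-2" _ "monom 1 ?n"])
          (use 3 large in \<open>auto simp: ev_def PQG(1,2) poly_monom\<close>)
    qed
  qed
  moreover have "poly Q (-1) = 0"
  proof -
    let ?h = "[:1, 1:] * (map_poly of_int P * map_poly of_int Q) - 2 * map_poly of_int Q ^ 2 :: real poly"
    \<comment> \<open>At \<open>-1\<close> the factor \<open>[:1, 1:]\<close> vanishes, so the limit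
      leaves only \<open>-2\<close> times the square of \<open>Q(-1)\<close>, which must be
      nonnegative.\<close>
    have "0 \<le> poly ?h (-1)"
    proof (rule poly_nonneg_limit)
      show "map_poly of_int G \<noteq> (0 :: real poly)"
        using PQG(3) by (auto simp: poly_eq_iff coeff_map_poly)
      show "-1 islimpt {-1<..<1 :: real}" by (rule islimpt_greaterThanLessThan1) simp
      fix y :: real assume "y \<in> {-1<..<1}"
      then have "\<bar>y\<bar> < 1" by auto
      then have "2 * (ev y d)\<^sup>2 \<le> (1 + y) * (ev y ?p * ev y d)"
        unfolding ev_sum by (rule weighting_ge_pair[OF finE TE _ weighting N0(1,2) adj])
      then show "0 \<le> (poly (map_poly of_int G) y)\<^sup>2 * poly ?h y"
        by (simp add: ev_def PQG(1,2) map_poly_of_int_mult power2_eq_square algebra_simps)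
    qed
    then have "poly (map_poly of_int Q) (-1 :: real) = 0" by simp
    then show ?thesis using poly_map_poly_of_int[of Q "-1", where 'a = real] by simp
  qed
  moreover have "Q \<noteq> 0" using low by (auto simp: lowest_terms_def)
  ultimately show ?thesis using low is_pole_quotient[OF cop, of "-1"] by auto
qed

end
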